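(* Let $K$ be a field of characteristic zero and let $L$ be a finite dimensional Lie algebra over $K$. If $L$ admits a derivation $d : L \to L$ such that $L^n \subseteq d(L)$ for some integer $n > 1$, then $L$ is solvable.
   Context: Derivations are $K$-linear. $L^n$ denotes the $n$-th term of the lower central series of $L$, indexed by $L^1 = L$ and $L^{k+1} = [L, L^k]$ (so $L^2 = [L,L]$). $d(L)$ denotes the image of $d$. *)

theory Defs
  imports Complex_Main
begin

locale lie_algebra = vector_space scale
  for scale :: "'k::field \<Rightarrow> 'l::ab_group_add \<Rightarrow> 'l" +
  fixes bracket :: "'l \<Rightarrow> 'l \<Rightarrow> 'l"
  assumes linear_bracket_right: "Vector_Spaces.linear scale scale (\<lambda>y. bracket x y)"
    and linear_bracket_left: "Vector_Spaces.linear scale scale (\<lambda>x. bracket x y)"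
    and bracket_self: "bracket x x = 0"
    and jacobi: "bracket x (bracket y z) + bracket y (bracket z x) + bracket z (bracket x y) = 0"
begin

definition derivation :: "('l \<Rightarrow> 'l) \<Rightarrow> bool" where
  "derivation d \<longleftrightarrow> Vector_Spaces.linear scale scale d \<and>
     (\<forall>x y. d (bracket x y) = bracket (d x) y + bracket x (d y))"

definition set_bracket :: "'l set \<Rightarrow> 'l set \<Rightarrow> 'l set" where
  "set_bracket A B = span {bracket a b | a b. a \<in> A \<and> b \<in> B}"

(* Indexed from 1: the first term is the whole algebra, the second its derived
   algebra. The value at 0 is a dummy. *)
fun lower_central :: "nat \<Rightarrow> 'l set" where
  "lower_central 0 = UNIV"
| "lower_central (Suc 0) = UNIV"
| "lower_central (Suc (Suc k)) = set_bracket UNIV (lower_central (Suc k))"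

primrec derived_series :: "nat \<Rightarrow> 'l set" where
  "derived_series 0 = UNIV"
| "derived_series (Suc k) = set_bracket (derived_series k) (derived_series k)"

definition solvable :: bool where
  "solvable \<longleftrightarrow> (\<exists>k. derived_series k = {0})"

end

end

(* The derived series stabilises at a perfect ideal P, which is stable under d and lies
   in every term of the lower central series, hence in d(L). Dividing by a maximal d-stable ideal of L
   properly contained in P, one may assume that P contains no d-stable ideals of L except 0 and P.
   Restricted to P, the Killing form of L is then zero or nondegenerate.
   If it is nondegenerate, then d is injective on P, because ker d is orthogonal to d(L), which
   contains P; and d acts on P as ad p for some p in P, so d p = [p, p] = 0, p = 0 and P = 0.
   If it is zero, then P lies in the radical of the Killing form of L, and Cartan's criterion, proved
   over the algebraic closure, makes every ad x with x in P nilpotent; by Engel's theorem the perfect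
   algebra P is 0. *)
theory Submission
  imports Defs "HOL-Algebra.Algebraic_Closure_Type" "HOL-Library.Function_Algebras"
begin

section \<open>Traces\<close>

text \<open>A copy of \<open>vector_space\<close> without the global interpretation for \<open>(*\<^sub>R)\<close>, which would
  capture the names of new constants.\<close>

locale linear_space = vector_space scale
  for scale :: "'a::field \<Rightarrow> 'b::ab_group_add \<Rightarrow> 'b"
begin

lemma linear_endoI:
  assumes "\<And>x y. f (x + y) = f x + f y" and "\<And>a x. f (scale a x) = scale a (f x)"
  shows "Vector_Spaces.linear scale scale f"
  using assms vector_space_axioms by (simp add: Vector_Spaces.linear_iff)

definition trace_on :: "'b set \<Rightarrow> ('b \<Rightarrow> 'b) \<Rightarrow> 'a" where
  "trace_on C f = (\<Sum>c\<in>C. representation C (f c) c)"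

lemma trace_on_add:
  assumes "independent C" and "f ` C \<subseteq> span C" and "g ` C \<subseteq> span C"
  shows "trace_on C (\<lambda>x. f x + g x) = trace_on C f + trace_on C g"
proof -
  have "representation C (f c + g c) c = representation C (f c) c + representation C (g c) c"
    if "c \<in> C" for c
    using assms that by (subst representation_add) auto
  then show ?thesis by (simp add: trace_on_def sum.distrib)
qed

lemma trace_on_scale:
  assumes "independent C" and "f ` C \<subseteq> span C"
  shows "trace_on C (\<lambda>x. scale a (f x)) = a * trace_on C f"
proof -
  have "representation C (scale a (f c)) c = a * representation C (f c) c"
    if "c \<in> C" for c
    using assms that by (subst representation_scale) auto
  then show ?thesis by (simp add: trace_on_def sum_distrib_left)
qed

lemma trace_on_diff:
  assumes "independent C" and "f ` C \<subseteq> span C" and "g ` C \<subseteq> span C"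
  shows "trace_on C (\<lambda>x. f x - g x) = trace_on C f - trace_on C g"
proof -
  have "representation C (f c - g c) c = representation C (f c) c - representation C (g c) c"
    if "c \<in> C" for c
    using assms that by (subst representation_diff) auto
  then show ?thesis by (simp add: trace_on_def sum_subtractf)
qed

lemma trace_on_cong:
  assumes "\<And>c. c \<in> C \<Longrightarrow> f c = g c"
  shows "trace_on C f = trace_on C g"
  using assms by (simp add: trace_on_def)

lemma trace_on_sum:
  assumes "independent C" and "\<And>i. i \<in> I \<Longrightarrow> f i ` C \<subseteq> span C"
  shows "trace_on C (\<lambda>x. \<Sum>i\<in>I. f i x) = (\<Sum>i\<in>I. trace_on C (f i))"
proof -
  have "representation C (\<Sum>i\<in>I. f i c) c = (\<Sum>i\<in>I. representation C (f i c) c)"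
    if "c \<in> C" for c
    using assms that by (subst representation_sum) auto
  then have "trace_on C (\<lambda>x. \<Sum>i\<in>I. f i x) = (\<Sum>c\<in>C. \<Sum>i\<in>I. representation C (f i c) c)"
    by (simp add: trace_on_def)
  also have "\<dots> = (\<Sum>i\<in>I. \<Sum>c\<in>C. representation C (f i c) c)" by (rule sum.swap)
  finally show ?thesis by (simp add: trace_on_def)
qed

lemma representation_linear_expand:
  assumes f: "Vector_Spaces.linear scale scale f"
    and D: "finite D" "independent D" and C: "independent C"
    and x: "x \<in> span D" and fD: "f ` D \<subseteq> span C"
  shows "representation C (f x) c = (\<Sum>e\<in>D. representation D x e * representation C (f e) c)"
proof -
  have "f x = f (\<Sum>e\<in>D. scale (representation D x e) e)"
    using sum_representation_eq[OF D(2) x D(1)] by simp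
  also have "\<dots> = (\<Sum>e\<in>D. scale (representation D x e) (f e))"
    using f by (simp add: linear_iff_module_hom module_hom.sum module_hom.scale)
  finally have "representation C (f x) c = (\<Sum>e\<in>D. representation C (scale (representation D x e) (f e)) c)"
    using C fD by (simp add: representation_sum span_scale image_subset_iff)
  also have "\<dots> = (\<Sum>e\<in>D. representation D x e * representation C (f e) c)"
    using C fD by (intro sum.cong) (auto simp: representation_scale)
  finally show ?thesis .
qed

lemma trace_on_commute:
  assumes f: "Vector_Spaces.linear scale scale f" and g: "Vector_Spaces.linear scale scale g"
    and C: "finite C" "independent C" and D: "finite D" "independent D"
    and gC: "g ` C \<subseteq> span D" and fD: "f ` D \<subseteq> span C"
  shows "trace_on C (\<lambda>x. f (g x)) = trace_on D (\<lambda>x. g (f x))"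
proof -
  have "trace_on C (\<lambda>x. f (g x))
    = (\<Sum>c\<in>C. \<Sum>e\<in>D. representation D (g c) e * representation C (f e) c)"
    unfolding trace_on_def using representation_linear_expand[OF f D C(2) _ fD] gC
    by (intro sum.cong) auto
  also have "\<dots> = (\<Sum>e\<in>D. \<Sum>c\<in>C. representation C (f e) c * representation D (g c) e)"
    by (subst sum.swap) (simp add: mult.commute)
  also have "\<dots> = trace_on D (\<lambda>x. g (f x))"
    unfolding trace_on_def using representation_linear_expand[OF g C D(2) _ gC] fD
    by (intro sum.cong) auto
  finally show ?thesis .
qed

lemma trace_on_basis_change:
  assumes f: "Vector_Spaces.linear scale scale f"
    and C: "finite C" "independent C" and D: "finite D" "independent D"
    and CD: "span C = span D" and fC: "f ` C \<subseteq> span C"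
  shows "trace_on C f = trace_on D f"
proof -
  have "f ` span C \<subseteq> span C"
    using f fC by (metis linear_iff_module_hom module_hom.span_image span_mono span_span)
  then have "f ` D \<subseteq> span C" using CD by (auto intro: span_base)
  moreover have "Vector_Spaces.linear scale scale (\<lambda>x. x)" by (rule linear_ident)
  moreover have "(\<lambda>x. x) ` C \<subseteq> span D" using CD by (auto intro: span_base)
  ultimately show ?thesis
    using trace_on_commute[OF f _ C D, of "\<lambda>x. x"] by simp
qed

end

section \<open>Generalised eigenspaces\<close>

locale linear_operator = linear_space scale
  for scale :: "'k::field \<Rightarrow> 'v::ab_group_add \<Rightarrow> 'v" +
  fixes T :: "'v \<Rightarrow> 'v"
  assumes T_linear: "Vector_Spaces.linear scale scale T"
begin

lemma T_hom: "module_hom scale scale T"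
  using T_linear by (simp add: linear_iff_module_hom)

lemma T_simps: "T (x + y) = T x + T y" "T (x - y) = T x - T y" "T (scale a x) = scale a (T x)" "T 0 = 0"
  using T_hom by (simp_all add: module_hom.add module_hom.diff module_hom.scale module_hom.zero)

definition shift :: "'k \<Rightarrow> 'v \<Rightarrow> 'v" where
  "shift l v = T v - scale l v"

definition gen_eigenspace :: "'k \<Rightarrow> 'v set" where
  "gen_eigenspace l = {v. \<exists>k. (shift l ^^ k) v = 0}"

lemma shift_simps: "shift l (x + y) = shift l x + shift l y" "shift l (x - y) = shift l x - shift l y"
  "shift l (scale a x) = scale a (shift l x)" "shift l 0 = 0"
  by (simp_all add: shift_def T_simps algebra_simps scale_right_distrib scale_right_diff_distrib)

lemma shift_pow_simps: "(shift l ^^ k) (x + y) = (shift l ^^ k) x + (shift l ^^ k) y"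
  "(shift l ^^ k) (x - y) = (shift l ^^ k) x - (shift l ^^ k) y"
  "(shift l ^^ k) (scale a x) = scale a ((shift l ^^ k) x)" "(shift l ^^ k) 0 = 0"
  by (induction k) (simp_all add: shift_simps)

lemma shift_pow_mono: "(shift l ^^ k) v = 0 \<Longrightarrow> k \<le> m \<Longrightarrow> (shift l ^^ m) v = 0"
  by (metis comp_apply funpow_add le_add_diff_inverse2 shift_pow_simps(4))

lemma shift_commute: "shift l (shift m v) = shift m (shift l v)"
  by (simp add: shift_def T_simps algebra_simps scale_right_diff_distrib)

lemma shift_pow_commute: "(shift l ^^ k) ((shift m ^^ j) v) = (shift m ^^ j) ((shift l ^^ k) v)"
proof -
  have *: "shift l ((shift m ^^ j) v) = (shift m ^^ j) (shift l v)" for v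
    by (induction j) (simp_all add: shift_commute[of l m])
  show ?thesis by (induction k) (simp_all add: *)
qed

lemma subspace_gen_eigenspace: "subspace (gen_eigenspace l)"
proof (rule subspaceI)
  show "0 \<in> gen_eigenspace l" by (auto simp: gen_eigenspace_def shift_pow_simps)
  show "scale c x \<in> gen_eigenspace l" if "x \<in> gen_eigenspace l" for c x
    using that by (auto simp: gen_eigenspace_def shift_pow_simps)
  show "x + y \<in> gen_eigenspace l" if xy: "x \<in> gen_eigenspace l" "y \<in> gen_eigenspace l" for x y
  proof -
    obtain k j where "(shift l ^^ k) x = 0" "(shift l ^^ j) y = 0"
      using xy by (auto simp: gen_eigenspace_def)
    then have "(shift l ^^ max k j) x = 0" "(shift l ^^ max k j) y = 0"
      by (meson shift_pow_mono max.cobounded1 max.cobounded2)+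
    then have "(shift l ^^ max k j) (x + y) = 0" by (simp add: shift_pow_simps)
    then show ?thesis by (auto simp: gen_eigenspace_def)
  qed
qed

lemma gen_eigenspaceI_shift: "shift l v \<in> gen_eigenspace l \<Longrightarrow> v \<in> gen_eigenspace l"
proof -
  assume "shift l v \<in> gen_eigenspace l"
  then obtain k where "(shift l ^^ k) (shift l v) = 0" by (auto simp: gen_eigenspace_def)
  then have "(shift l ^^ Suc k) v = 0" by (simp only: funpow_Suc_right comp_apply)
  then show ?thesis unfolding gen_eigenspace_def by blast
qed

lemma shift_pow_in_gen_eigenspace:
  "v \<in> gen_eigenspace l \<Longrightarrow> (shift m ^^ k) v \<in> gen_eigenspace l"
proof -
  assume "v \<in> gen_eigenspace l"
  then obtain j where "(shift l ^^ j) v = 0" by (auto simp: gen_eigenspace_def)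
  then have "(shift l ^^ j) ((shift m ^^ k) v) = 0"
    by (subst shift_pow_commute) (simp add: shift_pow_simps)
  then show ?thesis unfolding gen_eigenspace_def by blast
qed

lemma shift_shift: "shift l v = shift m v + scale (m - l) v"
  by (simp add: shift_def algebra_simps scale_left_diff_distrib)

lemma gen_eigenspace_shift_eq_0:
  assumes v: "v \<in> gen_eigenspace m" and ne: "l \<noteq> m" and 0: "shift l v = 0"
  shows "v = 0"
proof -
  have "shift m v = scale (l - m) v" using shift_shift[of m v l] 0 by simp
  then have "(shift m ^^ k) v = scale ((l - m) ^ k) v" for k
    by (induction k) (simp_all add: shift_simps mult.commute)
  moreover obtain k where "(shift m ^^ k) v = 0" using v by (auto simp: gen_eigenspace_def)
  ultimately have "scale ((l - m) ^ k) v = 0" by metis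
  then show ?thesis using ne by simp
qed

lemma gen_eigenspace_disjoint:
  assumes v: "v \<in> gen_eigenspace m" "v \<in> gen_eigenspace l" and ne: "l \<noteq> m"
  shows "v = 0"
proof -
  have "(shift l ^^ k) v = 0 \<Longrightarrow> v \<in> gen_eigenspace m \<Longrightarrow> v = 0" for k v
  proof (induction k arbitrary: v)
    case (Suc k)
    have "(shift l ^^ k) (shift l v) = 0" using Suc.prems(1) by (simp only: funpow_Suc_right comp_apply)
    moreover have "shift l v \<in> gen_eigenspace m"
      using shift_pow_in_gen_eigenspace[OF Suc.prems(2), where m = l and k = 1] by simp
    ultimately have "shift l v = 0" using Suc.IH by blast
    then show ?case using gen_eigenspace_shift_eq_0[OF Suc.prems(2) ne] by simp
  qed simp
  then show ?thesis using v by (auto simp: gen_eigenspace_def)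
qed

lemma gen_eigenspaces_independent:
  assumes "finite L" "m \<notin> L" "\<And>l. l \<in> L \<Longrightarrow> x l \<in> gen_eigenspace l"
    and "(\<Sum>l\<in>L. x l) \<in> gen_eigenspace m"
  shows "(\<Sum>l\<in>L. x l) = 0"
  using assms
proof (induction L arbitrary: x)
  case (insert l L)
  obtain k where k: "(shift l ^^ k) (x l) = 0"
    using insert.prems(2)[of l] by (auto simp: gen_eigenspace_def)
  have hom_sum: "(shift l ^^ k) (\<Sum>j\<in>L. x j) = (\<Sum>j\<in>L. (shift l ^^ k) (x j))"
    using insert.hyps(1) by (induction L) (simp_all add: shift_pow_simps)
  have eq: "(shift l ^^ k) (\<Sum>j\<in>insert l L. x j) = (\<Sum>j\<in>L. (shift l ^^ k) (x j))"
    using insert.hyps by (simp add: shift_pow_simps k hom_sum)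
  have "(\<Sum>j\<in>L. (shift l ^^ k) (x j)) = 0"
    using insert.prems insert.IH[of "\<lambda>j. (shift l ^^ k) (x j)"] eq
    by (metis insert_iff shift_pow_in_gen_eigenspace)
  then have "(\<Sum>j\<in>insert l L. x j) \<in> gen_eigenspace l"
    using eq by (auto simp: gen_eigenspace_def)
  then show ?case using gen_eigenspace_disjoint insert.prems by (metis insertI1)
qed simp

lemma shift_surj_on_gen_eigenspace:
  assumes U: "subspace U" "T ` U \<subseteq> U" and ne: "m \<noteq> l"
    and w: "w \<in> U" "w \<in> gen_eigenspace m"
  shows "\<exists>u\<in>U. shift l u = w"
proof -
  have "(shift m ^^ k) w = 0 \<Longrightarrow> w \<in> U \<Longrightarrow> \<exists>u\<in>U. shift l u = w" for k w
  proof (induction k arbitrary: w)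
    case 0
    then show ?case using subspace_0[OF U(1)] shift_simps(4) by auto
  next
    case (Suc k)
    have "(shift m ^^ k) (shift m w) = 0" using Suc.prems(1) by (simp only: funpow_Suc_right comp_apply)
    moreover have "shift m w \<in> U"
      unfolding shift_def using U Suc.prems(2) by (auto intro!: subspace_diff subspace_scale)
    ultimately obtain u where u: "u \<in> U" "shift l u = shift m w" using Suc.IH by blast
    define z where "z = scale (inverse (m - l)) (w - u)"
    have "z \<in> U" unfolding z_def using U(1) u(1) Suc.prems(2) by (intro subspace_scale subspace_diff)
    moreover have "shift l (w - u) = scale (m - l) w"
      using shift_shift[of l w m] u(2) by (simp add: shift_simps)
    then have "shift l z = w" using ne by (simp add: z_def shift_simps)
    ultimately show ?case by blast
  qed
  then show ?thesis using w by (auto simp: gen_eigenspace_def)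
qed

lemma shift_solve:
  assumes E: "T ` span E \<subseteq> span E" "\<And>e. e \<in> E \<Longrightarrow> \<exists>m. e \<in> gen_eigenspace m"
    and w: "w \<in> span E"
  shows "\<exists>u\<in>span E. w - shift l u \<in> gen_eigenspace l"
  using w
proof (induction rule: span_induct_alt)
  case base
  show ?case by (rule bexI[of _ 0]) (simp_all add: shift_simps span_zero subspace_0[OF subspace_gen_eigenspace])
next
  case (step c e y)
  obtain v where v: "v \<in> span E" "y - shift l v \<in> gen_eigenspace l" using step by blast
  obtain m where m: "e \<in> gen_eigenspace m" using E(2) step by blast
  obtain u where u: "u \<in> span E" "e - shift l u \<in> gen_eigenspace l"
  proof (cases "m = l")
    case True
    then show ?thesis using that[OF span_zero] m by (simp add: shift_simps)
  next
    case False
    then show ?thesis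
      using shift_surj_on_gen_eigenspace[OF subspace_span E(1) False span_base[OF step(1)] m] that
        subspace_0[OF subspace_gen_eigenspace] by force
  qed
  have "scale c (e - shift l u) + (y - shift l v) \<in> gen_eigenspace l"
    using u v by (intro subspace_add subspace_scale subspace_gen_eigenspace)
  then have "scale c e + y - shift l (scale c u + v) \<in> gen_eigenspace l"
    by (simp add: shift_simps scale_right_diff_distrib algebra_simps)
  moreover have "scale c u + v \<in> span E" using u v by (intro span_add span_scale)
  ultimately show ?case by blast
qed

lemma eigenvalue_function_on_gen_eigenspace:
  assumes E: "finite E" "independent E" "\<And>e. e \<in> E \<Longrightarrow> e \<in> gen_eigenspace (lam e)"
    and y: "Vector_Spaces.linear scale scale y" "\<And>e. e \<in> E \<Longrightarrow> y e = scale (g (lam e)) e"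
    and v: "v \<in> span E" "v \<in> gen_eigenspace m"
  shows "y v = scale (g m) v"
proof -
  define c where "c = representation E v"
  define Z where "Z l = (\<Sum>e\<in>{e\<in>E. lam e = l}. scale (c e) e)" for l
  define L where "L = lam ` E - {m}"
  have [simp]: "finite L" "m \<notin> L" using E(1) by (simp_all add: L_def)
  have Z: "Z l \<in> gen_eigenspace l" for l
    unfolding Z_def using E(3) by (intro subspace_sum subspace_scale subspace_gen_eigenspace) auto
  have vE: "v = (\<Sum>e\<in>E. scale (c e) e)"
    unfolding c_def using sum_representation_eq[OF E(2) v(1) E(1)] by simp
  have "v = (\<Sum>l\<in>insert m (lam ` E). Z l)"
    unfolding vE Z_def by (rule sum.group[symmetric]) (use E(1) in auto)
  also have "insert m (lam ` E) = insert m L" by (auto simp: L_def)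
  also have "(\<Sum>l\<in>insert m L. Z l) = Z m + (\<Sum>l\<in>L. Z l)" by simp
  finally have v_eq: "v = Z m + (\<Sum>l\<in>L. Z l)" .
  then have "(\<Sum>l\<in>L. Z l) = v - Z m" by simp
  then have "(\<Sum>l\<in>L. Z l) \<in> gen_eigenspace m"
    using v(2) Z subspace_diff[OF subspace_gen_eigenspace] by metis
  then have "(\<Sum>l\<in>L. Z l) = 0"
    by (intro gen_eigenspaces_independent[where m = m]) (auto simp: L_def E(1) Z)
  then have "v = Z m" using v_eq by simp
  moreover have "y (Z m) = scale (g m) (Z m)"
  proof -
    have "y (Z m) = (\<Sum>e\<in>{e\<in>E. lam e = m}. scale (c e) (y e))"
      using y(1) by (simp add: Z_def linear_iff_module_hom module_hom.sum module_hom.scale)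
    also have "\<dots> = (\<Sum>e\<in>{e\<in>E. lam e = m}. scale (g m) (scale (c e) e))"
      using y(2) by (intro sum.cong) (auto simp: mult.commute)
    finally show ?thesis by (simp add: Z_def scale_sum_right)
  qed
  ultimately show ?thesis by simp
qed

definition poly_op :: "'k poly \<Rightarrow> 'v \<Rightarrow> 'v" where
  "poly_op p v = (\<Sum>i\<le>degree p. scale (coeff p i) ((T ^^ i) v))"

lemma poly_op_le:
  assumes "degree p \<le> N"
  shows "poly_op p v = (\<Sum>i\<le>N. scale (coeff p i) ((T ^^ i) v))"
  unfolding poly_op_def
  by (rule sum.mono_neutral_left) (use assms in \<open>auto simp: coeff_eq_0\<close>)

lemma T_sum: "T (sum f I) = (\<Sum>i\<in>I. T (f i))"
  using T_hom by (simp add: module_hom.sum)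

lemma poly_op_linear_factor: "poly_op ([:- l, 1:] * q) v = shift l (poly_op q v)"
proof -
  define N where "N = degree q"
  have eq: "[:- l, 1:] * q = pCons 0 q - smult l q" by simp
  have deg: "degree ([:- l, 1:] * q) \<le> Suc N"
    unfolding N_def using degree_mult_le[of "[:- l, 1:]" q] by simp
  have "poly_op ([:- l, 1:] * q) v = (\<Sum>i\<le>Suc N. scale (coeff (pCons 0 q - smult l q) i) ((T ^^ i) v))"
    using poly_op_le[OF deg] unfolding eq .
  also have "\<dots> = (\<Sum>i\<le>Suc N. scale (coeff (pCons 0 q) i) ((T ^^ i) v))
      - (\<Sum>i\<le>Suc N. scale l (scale (coeff q i) ((T ^^ i) v)))"
    by (simp only: coeff_diff coeff_smult scale_left_diff_distrib sum_subtractf scale_scale)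
  also have "(\<Sum>i\<le>Suc N. scale (coeff (pCons 0 q) i) ((T ^^ i) v)) = T (poly_op q v)"
    by (subst sum.atMost_Suc_shift) (simp add: poly_op_def N_def T_sum T_simps)
  also have "(\<Sum>i\<le>Suc N. scale l (scale (coeff q i) ((T ^^ i) v))) = scale l (poly_op q v)"
    using poly_op_le[of q "Suc N" v] by (simp only: N_def scale_sum_right le_SucI order_refl)
  finally show ?thesis by (simp add: shift_def)
qed

lemma poly_op_in:
  assumes "subspace V" and "T ` V \<subseteq> V" and "v \<in> V"
  shows "poly_op p v \<in> V"
proof -
  have "(T ^^ i) v \<in> V" for i using assms by (induction i) auto
  then show ?thesis unfolding poly_op_def using assms(1) by (intro subspace_sum subspace_scale)
qed

lemma linear_relation_exists:
  assumes C: "finite C" and x: "\<And>i::nat. x i \<in> span C"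
  shows "\<exists>N a. (\<exists>i\<le>N. a i \<noteq> 0) \<and> (\<Sum>i\<le>N. scale (a i) (x i)) = 0"
proof (cases "inj_on x {..card C}")
  case True
  have "card (x ` {..card C}) = Suc (card C)" using True by (simp add: card_image)
  then have "dependent (x ` {..card C})"
    using independent_span_bound[OF C] x by (metis Suc_n_not_le_n image_subsetI)
  then obtain u where u: "\<exists>v\<in>x ` {..card C}. u v \<noteq> 0" "(\<Sum>v\<in>x ` {..card C}. scale (u v) v) = 0"
    by (auto simp: dependent_finite)
  have "(\<Sum>i\<le>card C. scale (u (x i)) (x i)) = 0"
    using u(2) by (simp add: sum.reindex[OF True])
  moreover have "\<exists>i\<le>card C. u (x i) \<noteq> 0" using u(1) by auto
  ultimately show ?thesis by (intro exI[of _ "card C"] exI[of _ "\<lambda>i. u (x i)"]) simp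
next
  case False
  then obtain i j where ij: "i \<le> card C" "j \<le> card C" "i \<noteq> j" "x i = x j"
    by (auto simp: inj_on_def)
  define a where "a k = (if k = i then 1 else if k = j then - 1 else 0 :: 'k)" for k
  have "(\<Sum>k\<le>card C. scale (a k) (x k)) = (\<Sum>k\<in>{i, j}. scale (a k) (x k))"
    by (rule sum.mono_neutral_right) (use ij in \<open>auto simp: a_def\<close>)
  also have "\<dots> = 0" using ij by (simp add: a_def)
  finally show ?thesis using ij(1) by (intro exI[of _ "card C"] exI[of _ a]) (auto simp: a_def)
qed

lemma annihilating_poly_exists:
  assumes C: "finite C" and TC: "T ` span C \<subseteq> span C" and v: "v \<in> span C"
  shows "\<exists>p. p \<noteq> 0 \<and> poly_op p v = 0"
proof -
  have "(T ^^ i) v \<in> span C" for i using TC v by (induction i) auto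
  from linear_relation_exists[of C "\<lambda>i. (T ^^ i) v", OF C this]
  obtain N a where a: "\<exists>i\<le>N. a i \<noteq> 0" "(\<Sum>i\<le>N. scale (a i) ((T ^^ i) v)) = 0"
    by auto
  define p where "p = (\<Sum>i\<le>N. monom (a i) i)"
  have co: "coeff p i = a i" if "i \<le> N" for i using that by (simp add: p_def coeff_sum)
  have "degree p \<le> N" unfolding p_def
    by (rule degree_sum_le) (auto intro: order.trans[OF degree_monom_le])
  then have "poly_op p v = 0" using a(2) co by (simp add: poly_op_le)
  moreover have "p \<noteq> 0" using a(1) co by auto
  ultimately show ?thesis by blast
qed

end

locale ac_linear_operator = linear_operator scale T
  for scale :: "'k::alg_closed_field \<Rightarrow> 'v::ab_group_add \<Rightarrow> 'v" and T
begin

lemma relative_eigenvector_exists: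
  assumes C: "finite C" "T ` span C \<subseteq> span C" and W: "subspace W"
    and v: "v \<in> span C" "v \<notin> W"
  shows "\<exists>u l. u \<in> span C \<and> u \<notin> W \<and> shift l u \<in> W"
proof -
  define P where "P p \<longleftrightarrow> p \<noteq> 0 \<and> poly_op p v \<in> W" for p
  have "\<exists>p. P p"
    using annihilating_poly_exists[OF C v(1)] subspace_0[OF W] by (auto simp: P_def)
  then obtain p where p: "P p" and min: "\<And>q. P q \<Longrightarrow> degree p \<le> degree q"
    using ex_has_least_nat[of P _ degree] by blast
  have "degree p > 0"
  proof (rule ccontr)
    assume "\<not> degree p > 0"
    then obtain a where a: "p = [:a:]" using degree_eq_zeroE by blast
    then have "a \<noteq> 0" "scale a v \<in> W" using p by (auto simp: P_def poly_op_def)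
    then show False using subspace_scale[OF W, of "scale a v" "inverse a"] v(2) by simp
  qed
  then obtain l where "poly p l = 0" using alg_closed_imp_poly_has_root by blast
  then obtain q where q: "p = [:- l, 1:] * q" by (auto simp: poly_eq_0_iff_dvd elim: dvdE)
  have "q \<noteq> 0" using p q by (auto simp: P_def)
  then have "degree p = Suc (degree q)" unfolding q by (subst degree_mult_eq) auto
  then have "\<not> P q" using min[of q] by auto
  then have "poly_op q v \<notin> W" using \<open>q \<noteq> 0\<close> by (simp add: P_def)
  moreover have "shift l (poly_op q v) \<in> W" using p by (simp add: P_def q poly_op_linear_factor del: mult_pCons_left)
  moreover have "poly_op q v \<in> span C" using poly_op_in[OF subspace_span C(2) v(1)] .
  ultimately show ?thesis by blast
qed

lemma triangular_basis_exists:
  assumes C: "finite C" "T ` span C \<subseteq> span C"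
  shows "\<exists>E. finite E \<and> independent E \<and> span E = span C \<and>
    (\<forall>e\<in>E. \<exists>l. e \<in> gen_eigenspace l \<and> shift l e \<in> span (E - {e}))"
proof -
  define Q where "Q E \<longleftrightarrow> independent E \<and> E \<subseteq> span C \<and>
    (\<forall>e\<in>E. \<exists>l. e \<in> gen_eigenspace l \<and> shift l e \<in> span (E - {e}))" for E
  have bound: "finite E \<and> card E < Suc (card C)" if "Q E" for E
    using independent_span_bound[OF C(1)] that by (auto simp: Q_def less_Suc_eq_le)
  have "Q {}" using independent_empty by (simp add: Q_def)
  then obtain E where E: "Q E" and max: "\<And>F. Q F \<Longrightarrow> card F \<le> card E"
    using ex_has_greatest_nat[of Q "{}" card "Suc (card C)"] bound by blast
  have fin: "finite E" using bound E by blast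
  have EQ: "\<exists>l. e \<in> gen_eigenspace l \<and> shift l e \<in> span (E - {e})" if "e \<in> E" for e
    using E that by (simp add: Q_def)
  have EC: "span E \<subseteq> span C" using E span_minimal[OF _ subspace_span] by (simp add: Q_def)
  have "T e \<in> span E" if "e \<in> E" for e
  proof -
    obtain l where "shift l e \<in> span (E - {e})" using EQ \<open>e \<in> E\<close> by blast
    then have "shift l e \<in> span E" using span_mono[of "E - {e}" E] by blast
    then have "shift l e + scale l e \<in> span E"
      by (rule span_add[OF _ span_scale[OF span_base[OF that]]])
    then show ?thesis by (simp add: shift_def)
  qed
  then have TE: "T ` span E \<subseteq> span E"
    by (metis T_hom image_subsetI module_hom.span_image span_minimal subspace_span)
  have "span C \<subseteq> span E"
  proof (rule ccontr)
    assume "\<not> span C \<subseteq> span E"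
    then obtain v where "v \<in> span C" "v \<notin> span E" by blast
    then obtain u l where u: "u \<in> span C" "u \<notin> span E" "shift l u \<in> span E"
      using relative_eigenvector_exists[OF C subspace_span] by blast
    obtain w where w: "w \<in> span E" "shift l u - shift l w \<in> gen_eigenspace l"
      using shift_solve[OF TE _ u(3)] EQ by blast
    define e where "e = u - w"
    have e: "e \<notin> span E" using u(2) w(1) span_add[of e E w] by (auto simp: e_def)
    have eG: "e \<in> gen_eigenspace l"
      by (rule gen_eigenspaceI_shift) (use w(2) in \<open>simp add: e_def shift_simps\<close>)
    have "shift l w \<in> span E" unfolding shift_def using w(1) TE by (intro span_diff span_scale) auto
    then have se: "shift l e \<in> span E" using u(3) by (simp add: e_def shift_simps span_diff)
    have "e \<in> span C" unfolding e_def using u(1) w(1) EC by (intro span_diff) auto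
    have notin: "e \<notin> E" using e span_base by blast
    have "Q (insert e E)"
      unfolding Q_def
    proof (intro conjI ballI)
      show "independent (insert e E)" using e E by (simp add: Q_def independent_insertI)
      show "insert e E \<subseteq> span C" using \<open>e \<in> span C\<close> E by (auto simp: Q_def)
      fix x assume "x \<in> insert e E"
      then consider "x = e" | "x \<in> E" "x \<noteq> e" using notin by blast
      then show "\<exists>l. x \<in> gen_eigenspace l \<and> shift l x \<in> span (insert e E - {x})"
      proof cases
        case 1
        then show ?thesis using eG se notin by auto
      next
        case 2
        then obtain m where "x \<in> gen_eigenspace m" "shift m x \<in> span (E - {x})"
          using EQ by blast
        moreover have "span (E - {x}) \<subseteq> span (insert e E - {x})" by (intro span_mono) auto
        ultimately show ?thesis by blast
      qed
    qed
    then show False using max[of "insert e E"] fin notin by simp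
  qed
  then have "span E = span C" using EC by blast
  then show ?thesis using E fin by (simp add: Q_def exI[of _ E])
qed

end

section \<open>Derivations with rational eigenvalues\<close>

lemma rational_functional_exists:
  fixes a :: "'k::field_char_0"
  assumes "a \<noteq> 0"
  shows "\<exists>\<phi>. (\<forall>x y. \<phi> (x + y) = \<phi> x + \<phi> y) \<and> (\<forall>q x. \<phi> (of_rat q * x) = q * \<phi> x) \<and> \<phi> a = 1"
proof -
  interpret Q: vector_space "\<lambda>q (x::'k). of_rat q * x"
    by unfold_locales (simp_all add: algebra_simps of_rat_add of_rat_mult)
  have ind: "Q.independent {a}" using assms by (simp add: Q.dependent_single)
  define B where "B = Q.extend_basis {a}"
  have B: "{a} \<subseteq> B" "Q.independent B" "Q.span B = UNIV"
    using Q.extend_basis_superset[OF ind] Q.independent_extend_basis[OF ind] Q.span_extend_basis[OF ind]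
    by (simp_all add: B_def)
  define \<phi> where "\<phi> x = Q.representation B x a" for x
  have "\<phi> (x + y) = \<phi> x + \<phi> y" for x y
    by (simp add: \<phi>_def Q.representation_add[OF B(2)] B(3))
  moreover have "\<phi> (of_rat q * x) = q * \<phi> x" for q x
    by (simp add: \<phi>_def Q.representation_scale[OF B(2)] B(3))
  moreover have "\<phi> a = 1"
    using B(1) by (simp add: \<phi>_def Q.representation_basis[OF B(2)])
  ultimately show ?thesis by blast
qed

locale algebra_derivation = linear_operator scale T
  for scale :: "'k::field \<Rightarrow> 'v::ab_group_add \<Rightarrow> 'v" and T +
  fixes br :: "'v \<Rightarrow> 'v \<Rightarrow> 'v"
  assumes br_left: "Vector_Spaces.linear scale scale (\<lambda>x. br x y)"
    and br_right: "Vector_Spaces.linear scale scale (br x)"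
    and T_br: "T (br x y) = br (T x) y + br x (T y)"
begin

lemma br_simps: "br (x + y) z = br x z + br y z" "br z (x + y) = br z x + br z y"
  "br (x - y) z = br x z - br y z" "br z (x - y) = br z x - br z y"
  "br (scale a x) z = scale a (br x z)" "br z (scale a x) = scale a (br z x)"
  "br 0 z = 0" "br z 0 = 0"
  using br_left[of z] br_right[of z]
  by (auto simp: linear_iff_module_hom dest: module_hom.add module_hom.diff module_hom.scale module_hom.zero)

lemma shift_br: "shift (l + m) (br x y) = br (shift l x) y + br x (shift m y)"
  by (simp add: shift_def T_br br_simps algebra_simps)

lemma br_gen_eigenspace:
  assumes "x \<in> gen_eigenspace l" "y \<in> gen_eigenspace m"
  shows "br x y \<in> gen_eigenspace (l + m)"
proof -
  have "(shift l ^^ j) x = 0 \<Longrightarrow> (shift m ^^ k) y = 0 \<Longrightarrow> br x y \<in> gen_eigenspace (l + m)" for j k x y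
  proof (induction "j + k" arbitrary: j k x y)
    case 0
    then show ?case by (simp add: br_simps subspace_0[OF subspace_gen_eigenspace])
  next
    case (Suc n)
    show ?case
    proof (cases "j = 0 \<or> k = 0")
      case True
      then show ?thesis using Suc.prems
        by (auto simp: br_simps subspace_0[OF subspace_gen_eigenspace])
    next
      case False
      then obtain j' k' where jk: "j = Suc j'" "k = Suc k'" by (metis not0_implies_Suc)
      have "br (shift l x) y \<in> gen_eigenspace (l + m)"
        using Suc.hyps(1)[of j' k "shift l x" y] Suc.hyps(2) Suc.prems jk
        by (simp add: funpow_swap1)
      moreover have "br x (shift m y) \<in> gen_eigenspace (l + m)"
        using Suc.hyps(1)[of j k' x "shift m y"] Suc.hyps(2) Suc.prems jk
        by (simp add: funpow_swap1)
      ultimately have "shift (l + m) (br x y) \<in> gen_eigenspace (l + m)"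
        unfolding shift_br by (intro subspace_add subspace_gen_eigenspace)
      then show ?thesis by (rule gen_eigenspaceI_shift)
    qed
  qed
  then show ?thesis using assms by (auto simp: gen_eigenspace_def)
qed

end

lemma (in vector_space) bilinear_eq_on_span:
  assumes F: "\<And>w. Vector_Spaces.linear scale scale (\<lambda>v. F v w)" "\<And>v. Vector_Spaces.linear scale scale (F v)"
    and G: "\<And>w. Vector_Spaces.linear scale scale (\<lambda>v. G v w)" "\<And>v. Vector_Spaces.linear scale scale (G v)"
    and eq: "\<And>v w. v \<in> E \<Longrightarrow> w \<in> E \<Longrightarrow> F v w = G v w"
    and vw: "v \<in> span E" "w \<in> span E"
  shows "F v w = G v w"
proof -
  interpret P: vector_space_pair scale scale ..
  have "F v w = G v w" if "v \<in> E" for v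
    using P.linear_eq_on[OF F(2) G(2) vw(2)] eq that by blast
  then show ?thesis using P.linear_eq_on[OF F(1) G(1) vw(1)] by blast
qed

locale ac_algebra_derivation = algebra_derivation scale T br + ac_linear_operator scale T
  for scale :: "'k::{alg_closed_field,field_char_0} \<Rightarrow> 'v::ab_group_add \<Rightarrow> 'v" and T br
begin

text \<open>For a \<open>\<rat>\<close>-linear functional \<open>\<phi>\<close>, the operator acting as \<open>\<phi> l\<close> on the generalised
  eigenspace of \<open>l\<close> is again a derivation, because \<open>\<phi>\<close> is additive. Its trace pairing with \<open>T\<close> is
  \<open>\<Sum> l \<cdot> \<phi> l\<close>, and applying \<open>\<phi>\<close> to this turns it into a sum of squares in \<open>\<rat>\<close>.\<close>

theorem nilpotent_if_trace_orthogonal_to_derivations: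
  assumes C: "finite C" "independent C" "T ` span C \<subseteq> span C"
    and brC: "\<And>v w. v \<in> span C \<Longrightarrow> w \<in> span C \<Longrightarrow> br v w \<in> span C"
    and tr: "\<And>y. Vector_Spaces.linear scale scale y \<Longrightarrow> y ` span C \<subseteq> span C \<Longrightarrow>
      (\<And>v w. v \<in> span C \<Longrightarrow> w \<in> span C \<Longrightarrow> y (br v w) = br (y v) w + br v (y w)) \<Longrightarrow>
      trace_on C (\<lambda>v. T (y v)) = 0"
  shows "span C \<subseteq> gen_eigenspace 0"
proof -
  obtain E where E: "finite E" "independent E" "span E = span C"
    and "\<forall>e\<in>E. \<exists>l. e \<in> gen_eigenspace l \<and> shift l e \<in> span (E - {e})"
    using triangular_basis_exists[OF C(1,3)] by blast
  then obtain lam where lam: "\<And>e. e \<in> E \<Longrightarrow> e \<in> gen_eigenspace (lam e)"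
    "\<And>e. e \<in> E \<Longrightarrow> shift (lam e) e \<in> span (E - {e})" by metis
  have "lam e0 = 0" if e0: "e0 \<in> E" for e0
  proof (rule ccontr)
    assume "lam e0 \<noteq> 0"
    then obtain \<phi> where \<phi>: "\<And>x y. \<phi> (x + y) = \<phi> x + \<phi> y" "\<And>q x. \<phi> (of_rat q * x) = q * \<phi> x"
      "\<phi> (lam e0) = 1" using rational_functional_exists by metis
    interpret P: vector_space_pair scale scale ..
    define g where "g l = (of_rat (\<phi> l) :: 'k)" for l
    obtain y where y: "Vector_Spaces.linear scale scale y" "\<And>e. e \<in> E \<Longrightarrow> y e = scale (g (lam e)) e"
      using P.linear_independent_extend[OF E(2), of "\<lambda>e. scale (g (lam e)) e"] by blast
    have hom: "module_hom scale scale y" using y(1) by (simp add: linear_iff_module_hom)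
    note y_gen = eigenvalue_function_on_gen_eigenspace[OF E(1,2) lam(1) y]
    have yC: "y ` span C \<subseteq> span C"
      using module_hom.span_image[OF hom, of E] y(2) E(3)
      by (metis (no_types, lifting) image_subset_iff span_base span_minimal span_scale subspace_span)
    have der: "y (br v w) = br (y v) w + br v (y w)" if vw: "v \<in> span C" "w \<in> span C" for v w
    proof (rule bilinear_eq_on_span[of "\<lambda>v w. y (br v w)" "\<lambda>v w. br (y v) w + br v (y w)" E])
      show "v \<in> span E" "w \<in> span E" using vw E(3) by auto
      fix v w
      show "Vector_Spaces.linear scale scale (\<lambda>v. y (br v w))" "Vector_Spaces.linear scale scale (\<lambda>w. y (br v w))"
        "Vector_Spaces.linear scale scale (\<lambda>v. br (y v) w + br v (y w))"
        "Vector_Spaces.linear scale scale (\<lambda>w. br (y v) w + br v (y w))"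
        using hom by (auto intro!: linear_endoI simp: br_simps module_hom.add module_hom.scale scale_right_distrib)
      assume e: "v \<in> E" "w \<in> E"
      have "br v w \<in> span E" using e brC E(3) by (metis span_base)
      then have "y (br v w) = scale (g (lam v + lam w)) (br v w)"
        using y_gen br_gen_eigenspace lam(1) e by blast
      also have "\<dots> = br (y v) w + br v (y w)"
        using y(2) e by (simp add: br_simps g_def \<phi>(1) of_rat_add scale_left_distrib)
      finally show "y (br v w) = br (y v) w + br v (y w)" .
    qed
    have "Vector_Spaces.linear scale scale (\<lambda>v. T (y v))"
      using hom by (intro linear_endoI) (simp_all add: module_hom.add module_hom.scale T_simps)
    then have "trace_on E (\<lambda>v. T (y v)) = 0"
      using tr[OF y(1) yC der] trace_on_basis_change[OF _ C(1,2) E(1,2) E(3)[symmetric]] C(3) yC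
      by (metis (no_types, lifting) image_subset_iff span_base)
    moreover have "representation E (T (y e)) e = g (lam e) * lam e" if e: "e \<in> E" for e
    proof -
      have s: "shift (lam e) e \<in> span (E - {e})" using lam(2) e by blast
      then have s': "shift (lam e) e \<in> span E" using span_mono[of "E - {e}" E] by blast
      have "representation E (shift (lam e) e) e = 0"
        using representation_extend[OF E(2) s] representation_ne_zero
        by (metis (no_types, lifting) Diff_iff Diff_subset singletonI)
      moreover have "T (y e) = scale (g (lam e)) (shift (lam e) e + scale (lam e) e)"
        using y(2)[OF e] by (simp add: T_simps shift_def)
      ultimately show ?thesis
        using s' e by (simp add: representation_scale[OF E(2)] representation_add[OF E(2)]
          representation_basis[OF E(2)] span_add span_scale span_base)
    qed
    ultimately have "(\<Sum>e\<in>E. g (lam e) * lam e) = 0" by (simp add: trace_on_def)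
    moreover have "\<phi> 0 = 0" using \<phi>(1)[of 0 0] by simp
    moreover have "\<phi> (\<Sum>e\<in>F. g (lam e) * lam e) = (\<Sum>e\<in>F. \<phi> (lam e) * \<phi> (lam e))" if "finite F" for F
      using that \<open>\<phi> 0 = 0\<close> by (induction F) (simp_all add: \<phi>(1,2) g_def)
    ultimately have "(\<Sum>e\<in>E. \<phi> (lam e) * \<phi> (lam e)) = 0" using E(1) by metis
    then have "\<forall>e\<in>E. \<phi> (lam e) * \<phi> (lam e) = 0"
      using sum_nonneg_eq_0_iff[OF E(1), of "\<lambda>e. \<phi> (lam e) * \<phi> (lam e)"] by simp
    then show False using e0 \<phi>(3) by force
  qed
  then have "E \<subseteq> gen_eigenspace 0" using lam(1) by fastforce
  then show ?thesis using span_minimal[OF _ subspace_gen_eigenspace] E(3) by metis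
qed

end

section \<open>The Killing form and extension of scalars\<close>

definition fun_scale :: "'k \<Rightarrow> ('b \<Rightarrow> 'k) \<Rightarrow> 'b \<Rightarrow> 'k::field" where
  "fun_scale a g = (\<lambda>b. a * g b)"

interpretation fun_space: linear_space fun_scale
  by unfold_locales (auto simp: fun_scale_def algebra_simps)

definition unit_fun :: "'b \<Rightarrow> 'b \<Rightarrow> 'k::field" where
  "unit_fun b = (\<lambda>c. if c = b then 1 else 0)"

lemma inj_unit_fun: "inj_on unit_fun B"
  unfolding inj_on_def unit_fun_def by (metis zero_neq_one)

lemma sum_fun_apply: "(sum f I :: 'b \<Rightarrow> 'k::field) x = (\<Sum>i\<in>I. f i x)"
  by (induction I rule: infinite_finite_induct) auto

lemma sum_unit_fun_apply:
  assumes "finite B"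
  shows "(\<Sum>c\<in>B. fun_scale (u c) (unit_fun c)) b = (if b \<in> B then u b else 0)"
proof -
  have "(\<Sum>c\<in>B. fun_scale (u c) (unit_fun c)) b = (\<Sum>c\<in>B. if c = b then u c else 0)"
    unfolding sum_fun_apply by (intro sum.cong) (auto simp: fun_scale_def unit_fun_def)
  then show ?thesis using assms by simp
qed

lemma independent_unit_fun:
  assumes "finite B"
  shows "fun_space.independent (unit_fun ` B :: ('b \<Rightarrow> 'k::field) set)"
proof
  assume "fun_space.dependent (unit_fun ` B :: ('b \<Rightarrow> 'k) set)"
  then obtain u b where u: "b \<in> B" "u (unit_fun b :: 'b \<Rightarrow> 'k) \<noteq> 0"
    "(\<Sum>v\<in>unit_fun ` B. fun_scale (u v) v) = 0"
    using assms by (auto simp: fun_space.dependent_finite)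
  have "(\<Sum>c\<in>B. fun_scale (u (unit_fun c)) (unit_fun c)) = (0 :: 'b \<Rightarrow> 'k)"
    using u(3) by (simp add: sum.reindex[OF inj_unit_fun])
  then have "(\<Sum>c\<in>B. fun_scale (u (unit_fun c)) (unit_fun c)) b = (0 :: 'k)" by simp
  then show False using u(1,2) by (simp add: sum_unit_fun_apply[OF assms])
qed

lemma span_unit_funI:
  assumes "finite B" and "\<And>b. b \<notin> B \<Longrightarrow> g b = 0"
  shows "g \<in> fun_space.span (unit_fun ` B)"
proof -
  have "g = (\<Sum>c\<in>B. fun_scale (g c) (unit_fun c))"
    by (rule ext) (use assms in \<open>simp add: sum_unit_fun_apply\<close>)
  then show ?thesis
    by (metis (no_types, lifting) fun_space.span_base fun_space.span_scale fun_space.span_sum image_eqI)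
qed

lemma representation_unit_fun:
  assumes B: "finite B" and g: "g \<in> fun_space.span (unit_fun ` B)" and b: "b \<in> B"
  shows "fun_space.representation (unit_fun ` B) g (unit_fun b) = g b"
proof -
  let ?r = "fun_space.representation (unit_fun ` B) g"
  have "g = (\<Sum>v\<in>unit_fun ` B. fun_scale (?r v) v)"
    using fun_space.sum_representation_eq[OF independent_unit_fun[OF B] g] B by simp
  also have "\<dots> = (\<Sum>c\<in>B. fun_scale (?r (unit_fun c)) (unit_fun c))"
    by (simp add: sum.reindex[OF inj_unit_fun])
  finally have "g b = (\<Sum>c\<in>B. fun_scale (?r (unit_fun c)) (unit_fun c)) b" by simp
  then show ?thesis using b by (simp add: sum_unit_fun_apply[OF B])
qed

lemma trace_on_unit_fun:
  assumes "finite B" and "\<And>b. b \<in> B \<Longrightarrow> F (unit_fun b) \<in> fun_space.span (unit_fun ` B)"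
  shows "fun_space.trace_on (unit_fun ` B) F = (\<Sum>b\<in>B. F (unit_fun b) b)"
  unfolding fun_space.trace_on_def sum.reindex[OF inj_unit_fun] comp_apply
  using assms by (intro sum.cong) (auto simp: representation_unit_fun)

locale fd_lie_algebra = lie_algebra scale bracket + finite_dimensional_vector_space scale Basis
    + linear_space scale
  for scale :: "'k::field_char_0 \<Rightarrow> 'l::ab_group_add \<Rightarrow> 'l"
    and bracket :: "'l \<Rightarrow> 'l \<Rightarrow> 'l" and Basis :: "'l set"
begin

lemma bracket_simps: "bracket (x + y) z = bracket x z + bracket y z" "bracket z (x + y) = bracket z x + bracket z y"
  "bracket (x - y) z = bracket x z - bracket y z" "bracket z (x - y) = bracket z x - bracket z y"
  "bracket (scale a x) z = scale a (bracket x z)" "bracket z (scale a x) = scale a (bracket z x)"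
  "bracket 0 z = 0" "bracket z 0 = 0" "bracket (- x) z = - bracket x z" "bracket z (- x) = - bracket z x"
  using linear_bracket_left[of z] linear_bracket_right[of z]
  by (auto simp: linear_iff_module_hom dest: module_hom.add module_hom.diff module_hom.scale module_hom.zero module_hom.neg)

lemma bracket_sum: "bracket (sum f I) z = (\<Sum>i\<in>I. bracket (f i) z)" "bracket z (sum f I) = (\<Sum>i\<in>I. bracket z (f i))"
  using linear_bracket_left[of z] linear_bracket_right[of z]
  by (auto simp: linear_iff_module_hom dest: module_hom.sum)

lemma bracket_anti: "bracket x y = - bracket y x"
proof -
  have "0 = bracket (x + y) (x + y)" by (simp only: bracket_self)
  also have "\<dots> = bracket x x + bracket y y + (bracket x y + bracket y x)"
    by (simp only: bracket_simps ac_simps)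
  finally show ?thesis by (simp add: bracket_self eq_neg_iff_add_eq_0)
qed

lemma bracket_bracket: "bracket (bracket x y) z = bracket x (bracket y z) - bracket y (bracket x z)"
  using jacobi[of x y z] bracket_anti[of "bracket x y" z] bracket_anti[of z x]
  by (simp add: bracket_simps algebra_simps add_eq_0_iff)

lemma representation_Basis_sum: "(\<Sum>b\<in>Basis. scale (representation Basis v b) b) = v"
  using sum_representation_eq[OF independent_Basis _ finite_Basis, of v] span_Basis by simp

definition trace :: "('l \<Rightarrow> 'l) \<Rightarrow> 'k" where
  "trace = trace_on Basis"

lemma trace_simps: "trace (\<lambda>x. f x + g x) = trace f + trace g" "trace (\<lambda>x. f x - g x) = trace f - trace g"
  "trace (\<lambda>x. scale a (f x)) = a * trace f"
  unfolding trace_def by (simp_all add: trace_on_add trace_on_diff trace_on_scale independent_Basis span_Basis)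

lemma trace_commute:
  assumes "Vector_Spaces.linear scale scale f" and "Vector_Spaces.linear scale scale g"
  shows "trace (\<lambda>x. f (g x)) = trace (\<lambda>x. g (f x))"
  unfolding trace_def using assms
  by (intro trace_on_commute) (simp_all add: finite_Basis independent_Basis span_Basis)

definition killing :: "'l \<Rightarrow> 'l \<Rightarrow> 'k" where
  "killing x y = trace (\<lambda>z. bracket x (bracket y z))"

lemma killing_simps: "killing (x + y) z = killing x z + killing y z" "killing z (x + y) = killing z x + killing z y"
  "killing (x - y) z = killing x z - killing y z" "killing z (x - y) = killing z x - killing z y"
  "killing (scale a x) z = a * killing x z" "killing z (scale a x) = a * killing z x"
  by (simp_all add: killing_def bracket_simps trace_simps)

lemma killing_0: "killing 0 z = 0" "killing z 0 = 0"
  using killing_simps(3)[of z z z] killing_simps(4)[of z z z] by auto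

lemma killing_neg: "killing (- x) z = - killing x z" "killing z (- x) = - killing z x"
  using killing_simps(3)[of 0 x z] killing_simps(4)[of z 0 x] by (auto simp: killing_0)

lemma killing_invariant: "killing (bracket x y) z = killing x (bracket y z)"
proof -
  have "Vector_Spaces.linear scale scale (\<lambda>w. bracket x (bracket z w))"
    by (rule linear_endoI) (simp_all add: bracket_simps)
  then have "trace (\<lambda>w. bracket y (bracket x (bracket z w))) = trace (\<lambda>w. bracket x (bracket z (bracket y w)))"
    using trace_commute[OF linear_bracket_right] by blast
  then show ?thesis by (simp add: killing_def bracket_bracket bracket_simps trace_simps)
qed

text \<open>Extension of scalars: an element of the algebra over the algebraic closure is given by its
  coordinates with respect to \<open>Basis\<close>.\<close>

definition emb :: "'l \<Rightarrow> 'l \<Rightarrow> 'k alg_closure" where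
  "emb v = (\<lambda>b. to_ac (representation Basis v b))"

definition ext_ad :: "'l \<Rightarrow> ('l \<Rightarrow> 'k alg_closure) \<Rightarrow> 'l \<Rightarrow> 'k alg_closure" where
  "ext_ad u h = (\<Sum>b\<in>Basis. fun_scale (h b) (emb (bracket u b)))"

definition ext_bracket :: "('l \<Rightarrow> 'k alg_closure) \<Rightarrow> ('l \<Rightarrow> 'k alg_closure) \<Rightarrow> 'l \<Rightarrow> 'k alg_closure" where
  "ext_bracket g h = (\<Sum>a\<in>Basis. fun_scale (g a) (ext_ad a h))"

abbreviation ext_space :: "('l \<Rightarrow> 'k alg_closure) set" where
  "ext_space \<equiv> fun_space.span (unit_fun ` Basis)"

lemma emb_simps: "emb (x + y) = emb x + emb y" "emb (x - y) = emb x - emb y" "emb (scale a x) = fun_scale (to_ac a) (emb x)" "emb 0 = 0"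
  by (auto simp: emb_def fun_scale_def representation_add[OF independent_Basis] representation_diff[OF independent_Basis]
      representation_scale[OF independent_Basis] representation_zero span_Basis)

lemma emb_sum: "emb (sum f I) = (\<Sum>i\<in>I. emb (f i))"
  by (induction I rule: infinite_finite_induct) (simp_all add: emb_simps)

lemma emb_Basis: "b \<in> Basis \<Longrightarrow> emb b = unit_fun b"
  by (auto simp: emb_def unit_fun_def representation_basis[OF independent_Basis])

lemma emb_in: "emb v \<in> ext_space"
  using representation_ne_zero[of Basis v] by (intro span_unit_funI finite_Basis) (auto simp: emb_def)

lemma emb_eq_0: "emb v = 0 \<longleftrightarrow> v = 0"
proof
  assume "emb v = 0"
  then have "representation Basis v b = 0" for b
    by (metis emb_def to_ac_eq_0_iff zero_fun_apply)
  then show "v = 0" using representation_Basis_sum[of v] by simp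
qed (simp add: emb_simps)

lemma ext_ad_right: "ext_ad u (g + h) = ext_ad u g + ext_ad u h" "ext_ad u (fun_scale c h) = fun_scale c (ext_ad u h)"
  by (auto simp: ext_ad_def fun_scale_def sum_fun_apply sum.distrib sum_distrib_left algebra_simps)

lemma ext_ad_left: "ext_ad (u + v) h = ext_ad u h + ext_ad v h" "ext_ad (scale a u) h = fun_scale (to_ac a) (ext_ad u h)"
  "ext_ad 0 h = 0"
  by (auto simp: ext_ad_def fun_scale_def sum_fun_apply sum.distrib sum_distrib_left algebra_simps bracket_simps emb_simps)

lemma ext_ad_right_sum: "ext_ad u (\<Sum>i\<in>I. fun_scale (c i) (h i)) = (\<Sum>i\<in>I. fun_scale (c i) (ext_ad u (h i)))"
  using ext_ad_right(2)[of u 0 0]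
  by (induction I rule: infinite_finite_induct) (simp_all add: ext_ad_right)

lemma ext_ad_left_sum: "ext_ad (\<Sum>i\<in>I. scale (c i) (u i)) h = (\<Sum>i\<in>I. fun_scale (to_ac (c i)) (ext_ad (u i) h))"
  by (induction I rule: infinite_finite_induct) (simp_all add: ext_ad_left)

lemma ext_bracket_left: "ext_bracket (f + g) h = ext_bracket f h + ext_bracket g h" "ext_bracket (fun_scale c g) h = fun_scale c (ext_bracket g h)"
  by (auto simp: ext_bracket_def fun_scale_def sum_fun_apply sum.distrib sum_distrib_left algebra_simps)

lemma ext_bracket_right: "ext_bracket f (g + h) = ext_bracket f g + ext_bracket f h" "ext_bracket f (fun_scale c h) = fun_scale c (ext_bracket f h)"
  by (simp_all add: ext_bracket_def ext_ad_right fun_space.scale_right_distrib sum.distrib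
      fun_space.scale_sum_right mult.commute)

lemma ext_bracket_left_sum: "ext_bracket (\<Sum>i\<in>I. fun_scale (c i) (g i)) h = (\<Sum>i\<in>I. fun_scale (c i) (ext_bracket (g i) h))"
  using ext_bracket_left(2)[of 0 0 h]
  by (induction I rule: infinite_finite_induct) (simp_all add: ext_bracket_left)

lemma ext_ad_emb: "ext_ad u (emb v) = emb (bracket u v)"
proof -
  have "emb (bracket u v) = emb (\<Sum>b\<in>Basis. scale (representation Basis v b) (bracket u b))"
    by (subst representation_Basis_sum[of v, symmetric]) (simp add: bracket_sum bracket_simps)
  then show ?thesis by (simp add: ext_ad_def emb_sum emb_simps emb_def[of v])
qed

lemma ext_bracket_emb: "ext_bracket (emb u) h = ext_ad u h"
proof -
  have "ext_ad u h = ext_ad (\<Sum>b\<in>Basis. scale (representation Basis u b) b) h"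
    by (simp add: representation_Basis_sum)
  then show ?thesis by (simp add: ext_bracket_def ext_ad_left_sum emb_def[of u])
qed

lemma ext_ad_ext_ad: "ext_ad x (ext_ad a h) = ext_ad (bracket x a) h + ext_ad a (ext_ad x h)"
proof -
  have "ext_ad x (ext_ad a h) = (\<Sum>b\<in>Basis. fun_scale (h b) (emb (bracket x (bracket a b))))" for x a
    unfolding ext_ad_def[of a h] by (simp add: ext_ad_right_sum ext_ad_emb)
  then show ?thesis
    by (simp add: ext_ad_def[of "bracket x a"] bracket_bracket emb_simps sum.distrib[symmetric]
        fun_space.scale_right_distrib[symmetric])
qed

lemma ext_ad_ext_bracket: "ext_ad x (ext_bracket g h) = ext_bracket (ext_ad x g) h + ext_bracket g (ext_ad x h)"
proof -
  have "ext_ad x (ext_bracket g h) = (\<Sum>a\<in>Basis. fun_scale (g a) (ext_ad (bracket x a) h + ext_ad a (ext_ad x h)))"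
    by (simp add: ext_bracket_def[of g h] ext_ad_right_sum ext_ad_ext_ad[of x])
  then show ?thesis
    by (simp add: ext_bracket_def[of g "ext_ad x h"] ext_ad_def[of x g] ext_bracket_left_sum ext_bracket_emb
        fun_space.scale_right_distrib sum.distrib)
qed

lemma ext_ad_in: "ext_ad u h \<in> ext_space"
  unfolding ext_ad_def by (intro fun_space.span_sum fun_space.span_scale emb_in)

lemma ext_bracket_in: "ext_bracket g h \<in> ext_space"
  unfolding ext_bracket_def by (intro fun_space.span_sum fun_space.span_scale ext_ad_in)

lemma linear_ext_ad: "Vector_Spaces.linear fun_scale fun_scale (ext_ad u)"
  by (rule fun_space.linear_endoI) (simp_all add: ext_ad_right)

lemma trace_ext_ad: "fun_space.trace_on (unit_fun ` Basis) (\<lambda>w. ext_ad u (ext_ad v w)) = to_ac (killing u v)"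
proof -
  have "fun_space.trace_on (unit_fun ` Basis) (\<lambda>w. ext_ad u (ext_ad v w))
    = (\<Sum>b\<in>Basis. ext_ad u (ext_ad v (unit_fun b)) b)"
    by (intro trace_on_unit_fun finite_Basis ext_ad_in)
  also have "\<dots> = (\<Sum>b\<in>Basis. emb (bracket u (bracket v b)) b)"
    by (intro sum.cong) (simp_all add: emb_Basis[symmetric] ext_ad_emb)
  also have "\<dots> = to_ac (killing u v)"
    by (simp add: emb_def killing_def trace_def trace_on_def to_ac_sum)
  finally show ?thesis .
qed

lemma trace_ext_ad_derivation_eq_0:
  assumes y: "Vector_Spaces.linear fun_scale fun_scale y" "y ` ext_space \<subseteq> ext_space"
    and der: "\<And>v w. v \<in> ext_space \<Longrightarrow> w \<in> ext_space \<Longrightarrow> y (ext_bracket v w) = ext_bracket (y v) w + ext_bracket v (y w)"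
    and x: "x \<in> span {bracket u v | u v. \<forall>w. killing u w = 0}"
  shows "fun_space.trace_on (unit_fun ` Basis) (\<lambda>w. ext_ad x (y w)) = 0"
  using x
proof (induction rule: span_induct_alt)
  case base
  show ?case
    by (simp only: ext_ad_left fun_space.trace_on_def fun_space.representation_zero sum.neutral_const)
next
  case (step c x' z)
  let ?C = "unit_fun ` Basis :: ('l \<Rightarrow> 'k alg_closure) set"
  let ?tr = "fun_space.trace_on ?C"
  have ind: "fun_space.independent ?C" by (intro independent_unit_fun finite_Basis)
  have fin: "finite ?C" using finite_Basis by simp
  have hom: "module_hom fun_scale fun_scale y" using y(1) by (simp add: linear_iff_module_hom)
  obtain u v where uv: "x' = bracket u v" "\<And>w. killing u w = 0" using step by auto
  have lin: "Vector_Spaces.linear fun_scale fun_scale (\<lambda>w. ext_ad u (y w))"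
    using hom by (intro fun_space.linear_endoI) (simp_all add: ext_ad_right module_hom.add module_hom.scale)
  have y_ext: "ext_ad v (y w) = y (ext_ad v w) - (\<Sum>b\<in>Basis. fun_scale (y (emb v) b) (ext_ad b w))"
    if "w \<in> ext_space" for w
    using der[OF emb_in that, of v] by (simp add: ext_bracket_emb ext_bracket_def[of "y (emb v)"] algebra_simps)
  have "ext_ad x' (y w) = ext_ad u (ext_ad v (y w)) - ext_ad v (ext_ad u (y w))" for w
    using ext_ad_ext_ad[of u v "y w"] uv(1) by simp
  then have "?tr (\<lambda>w. ext_ad x' (y w)) = ?tr (\<lambda>w. ext_ad u (ext_ad v (y w))) - ?tr (\<lambda>w. ext_ad v (ext_ad u (y w)))"
    using ind by (simp add: fun_space.trace_on_diff image_subset_iff ext_ad_in)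
  also have "?tr (\<lambda>w. ext_ad v (ext_ad u (y w))) = ?tr (\<lambda>w. ext_ad u (y (ext_ad v w)))"
    using fun_space.trace_on_commute[OF linear_ext_ad lin fin ind fin ind] by (simp add: image_subset_iff ext_ad_in)
  also have "?tr (\<lambda>w. ext_ad u (ext_ad v (y w))) - ?tr (\<lambda>w. ext_ad u (y (ext_ad v w)))
    = ?tr (\<lambda>w. ext_ad u (ext_ad v (y w)) - ext_ad u (y (ext_ad v w)))"
    using ind by (subst fun_space.trace_on_diff) (simp_all add: image_subset_iff ext_ad_in)
  also have "\<dots> = ?tr (\<lambda>w. \<Sum>b\<in>Basis. fun_scale (- y (emb v) b) (ext_ad u (ext_ad b w)))"
  proof (rule fun_space.trace_on_cong)
    fix w assume "w \<in> ?C"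
    then have w: "w \<in> ext_space" by (rule fun_space.span_base)
    have "ext_ad u (y (ext_ad v w)) = ext_ad u (ext_ad v (y w) + (\<Sum>b\<in>Basis. fun_scale (y (emb v) b) (ext_ad b w)))"
      by (simp add: y_ext[OF w])
    then show "ext_ad u (ext_ad v (y w)) - ext_ad u (y (ext_ad v w))
      = (\<Sum>b\<in>Basis. fun_scale (- y (emb v) b) (ext_ad u (ext_ad b w)))"
      by (simp add: ext_ad_right ext_ad_right_sum sum_negf)
  qed
  also have "\<dots> = (\<Sum>b\<in>Basis. ?tr (\<lambda>w. fun_scale (- y (emb v) b) (ext_ad u (ext_ad b w))))"
    using ind by (intro fun_space.trace_on_sum) (auto intro!: fun_space.span_scale fun_space.span_neg ext_ad_in)
  also have "\<dots> = (\<Sum>b\<in>Basis. - y (emb v) b * to_ac (killing u b))"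
    using ind by (intro sum.cong refl, subst fun_space.trace_on_scale) (auto simp: trace_ext_ad ext_ad_in)
  also have "\<dots> = 0" by (simp add: uv(2))
  finally have tr0: "?tr (\<lambda>w. ext_ad x' (y w)) = 0" .
  have "?tr (\<lambda>w. ext_ad (scale c x' + z) (y w)) = ?tr (\<lambda>w. fun_scale (to_ac c) (ext_ad x' (y w)) + ext_ad z (y w))"
    by (simp add: ext_ad_left)
  also have "\<dots> = to_ac c * ?tr (\<lambda>w. ext_ad x' (y w)) + ?tr (\<lambda>w. ext_ad z (y w))"
    using ind by (subst fun_space.trace_on_add)
      (auto simp: fun_space.trace_on_scale image_subset_iff ext_ad_in fun_space.span_scale)
  finally show ?case using tr0 step by simp
qed

theorem killing_radical_ad_nilpotent:
  assumes x: "x \<in> span {bracket u v | u v. \<forall>w. killing u w = 0}"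
  shows "\<exists>k. (bracket x ^^ k) z = 0"
proof -
  let ?C = "unit_fun ` Basis :: ('l \<Rightarrow> 'k alg_closure) set"
  interpret E: ac_algebra_derivation fun_scale "ext_ad x" ext_bracket
    by unfold_locales (auto intro!: fun_space.linear_endoI
      simp: ext_ad_right ext_bracket_left ext_bracket_right ext_ad_ext_bracket linear_ext_ad)
  have "ext_space \<subseteq> E.gen_eigenspace 0"
  proof (rule E.nilpotent_if_trace_orthogonal_to_derivations)
    show "finite ?C" "fun_space.independent ?C" using finite_Basis by (auto simp: independent_unit_fun)
  qed (auto simp: ext_ad_in ext_bracket_in intro: trace_ext_ad_derivation_eq_0[OF _ _ _ x])
  then have "emb z \<in> E.gen_eigenspace 0" using emb_in by blast
  moreover have "E.shift 0 = ext_ad x" by (simp add: E.shift_def fun_eq_iff)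
  moreover have "(ext_ad x ^^ k) (emb z) = emb ((bracket x ^^ k) z)" for k
    by (induction k) (simp_all add: ext_ad_emb)
  ultimately show ?thesis by (auto simp: E.gen_eigenspace_def emb_eq_0)
qed

section \<open>Engel's theorem\<close>

lemma maximal_subspace_exists:
  assumes "Q S" and "\<And>S. Q S \<Longrightarrow> subspace S"
  obtains M where "Q M" "\<And>S. Q S \<Longrightarrow> M \<subseteq> S \<Longrightarrow> S = M"
proof -
  obtain M where M: "Q M" "\<And>S. Q S \<Longrightarrow> dim S \<le> dim M"
    using ex_has_greatest_nat[of Q S dim "Suc dimension"] assms(1) dim_subset_UNIV
    by (metis less_Suc_eq_le)
  have "S = M" if "Q S" "M \<subseteq> S" for S
    using subspace_dim_equal[of M S] M that assms(2) by metis
  then show ?thesis using that M(1) by blast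
qed

lemma span_insert_subspaceE:
  assumes "x \<in> span (insert a M)" and "subspace M"
  obtains i where "x - scale i a \<in> M"
proof -
  have "span M = M" using assms(2) by simp
  moreover obtain i where "x - scale i a \<in> span M" using assms(1) unfolding span_insert by auto
  ultimately show ?thesis using that by metis
qed

lemma engel_relative:
  assumes "subspace A" and "\<And>a b. a \<in> A \<Longrightarrow> b \<in> A \<Longrightarrow> bracket a b \<in> A"
    and "\<And>a v. a \<in> A \<Longrightarrow> \<exists>k. (bracket a ^^ k) v = 0"
    and "subspace V" and "subspace U" and "U \<subset> V"
    and "\<And>a v. a \<in> A \<Longrightarrow> v \<in> V \<Longrightarrow> bracket a v \<in> V"
    and "\<And>a u. a \<in> A \<Longrightarrow> u \<in> U \<Longrightarrow> bracket a u \<in> U"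
  shows "\<exists>v\<in>V - U. \<forall>a\<in>A. bracket a v \<in> U"
  using assms
proof (induction "dim A" arbitrary: A V U rule: less_induct)
  case less
  note A = less.prems(1,2) and nilp = less.prems(3) and U = less.prems(5,6,8) and V = less.prems(4,7)
  show ?case
  proof (cases "A = {0}")
    case True
    then show ?thesis using U(1,2) subspace_0 by (auto simp: bracket_simps)
  next
    case False
    define Q where "Q M \<longleftrightarrow> subspace M \<and> M \<subset> A \<and> (\<forall>a\<in>M. \<forall>b\<in>M. bracket a b \<in> M)" for M
    have "Q {0}" using False subspace_0[OF A(1)] by (auto simp: Q_def bracket_simps)
    then obtain M where QM: "Q M" and max: "\<And>S. Q S \<Longrightarrow> M \<subseteq> S \<Longrightarrow> S = M"
      using maximal_subspace_exists[of Q] by (metis Q_def)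
    have M: "subspace M" "M \<subset> A" "\<And>a b. a \<in> M \<Longrightarrow> b \<in> M \<Longrightarrow> bracket a b \<in> M"
      using QM by (auto simp: Q_def)
    have dimM: "dim M < dim A"
      using dim_psubset[of M A] M(1,2) A(1) by (metis span_eq_iff)
    have nilpM: "\<And>a v. a \<in> M \<Longrightarrow> \<exists>k. (bracket a ^^ k) v = 0" using nilp M(2) by blast
    obtain a where a: "a \<in> A" "a \<notin> M" "\<And>m. m \<in> M \<Longrightarrow> bracket m a \<in> M"
      using less.hyps[OF dimM M(1,3) nilpM A(1) M(1,2)] A(2) M(2,3) by (metis DiffE psubsetD)
    have aM: "bracket a m \<in> M" if "m \<in> M" for m
      using a(3)[OF that] bracket_anti[of a m] subspace_neg[OF M(1)] by simp
    have "Q (span (insert a M)) \<or> span (insert a M) = A"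
    proof -
      have "bracket x y \<in> span (insert a M)"
        if "x \<in> span (insert a M)" "y \<in> span (insert a M)" for x y
      proof -
        from that obtain i j m n where "x = m + scale i a" "y = n + scale j a" "m \<in> M" "n \<in> M"
          using span_insert_subspaceE[OF _ M(1), of x a] span_insert_subspaceE[OF _ M(1), of y a]
          by (metis diff_add_cancel)
        then have "bracket x y \<in> M"
          using M(1,3) a(3) aM
          by (auto simp: bracket_simps bracket_self intro!: subspace_add subspace_scale)
        then show ?thesis by (auto intro: span_base)
      qed
      moreover have "span (insert a M) \<subseteq> A" using a(1) M(2) A(1) by (intro span_minimal) auto
      ultimately show ?thesis unfolding Q_def by auto
    qed
    moreover have "M \<subseteq> span (insert a M)" "a \<in> span (insert a M)" by (auto intro: span_base)
    ultimately have A_eq: "span (insert a M) = A" using max a(2) by metis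
    obtain v where v: "v \<in> V" "v \<notin> U" "\<And>m. m \<in> M \<Longrightarrow> bracket m v \<in> U"
    proof -
      have "\<exists>v\<in>V - U. \<forall>a\<in>M. bracket a v \<in> U"
        by (rule less.hyps[OF dimM M(1,3) nilpM V(1) U(1,2)]) (use V(2) U(3) M(2) in auto)
      then show ?thesis using that by blast
    qed
    obtain n where n: "(bracket a ^^ n) v = 0" using nilp a(1) by blast
    define k where "k = (LEAST k. (bracket a ^^ k) v \<in> U)"
    have k: "(bracket a ^^ k) v \<in> U" and least: "\<And>j. j < k \<Longrightarrow> (bracket a ^^ j) v \<notin> U"
      unfolding k_def using n subspace_0[OF U(1)]
      by (auto intro: LeastI[of "\<lambda>k. (bracket a ^^ k) v \<in> U" n] dest: not_less_Least)
    obtain j where j: "k = Suc j" using k v(2) by (cases k) auto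
    have W: "(bracket a ^^ i) v \<in> V \<and> (\<forall>m\<in>M. bracket m ((bracket a ^^ i) v) \<in> U)" for i
    proof (induction i)
      case (Suc i)
      have "bracket m (bracket a w) = bracket (bracket m a) w + bracket a (bracket m w)" for m w
        by (simp add: bracket_bracket)
      then show ?case using Suc a V(2) U(1,3) by (auto intro!: subspace_add)
    qed (use v in simp)
    define w where "w = (bracket a ^^ j) v"
    have w: "w \<in> V" "w \<notin> U" "\<And>m. m \<in> M \<Longrightarrow> bracket m w \<in> U" "bracket a w \<in> U"
      using W[of j] least[of j] k j by (auto simp: w_def)
    have "bracket x w \<in> U" if "x \<in> A" for x
    proof -
      have "x \<in> span (insert a M)" using that A_eq by simp
      then obtain i where "x - scale i a \<in> M" using M(1) by (rule span_insert_subspaceE)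
      then have "bracket (x - scale i a) w + scale i (bracket a w) \<in> U"
        using w U(1) by (intro subspace_add subspace_scale) auto
      then show ?thesis by (simp add: bracket_simps)
    qed
    then show ?thesis using w by blast
  qed
qed

lemma set_bracketI: "a \<in> A \<Longrightarrow> b \<in> B \<Longrightarrow> bracket a b \<in> set_bracket A B"
  unfolding set_bracket_def by (rule span_base) blast

lemma set_bracket_subset:
  assumes "subspace S" and "\<And>a b. a \<in> A \<Longrightarrow> b \<in> B \<Longrightarrow> bracket a b \<in> S"
  shows "set_bracket A B \<subseteq> S"
  unfolding set_bracket_def by (rule span_minimal) (use assms in auto)

lemma subspace_set_bracket: "subspace (set_bracket A B)"
  unfolding set_bracket_def by (rule subspace_span)

lemma perfect_ad_nilpotent_trivial:
  assumes P: "set_bracket P P = P" and nilp: "\<And>a v. a \<in> P \<Longrightarrow> \<exists>k. (bracket a ^^ k) v = 0"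
  shows "P = {0}"
proof (rule ccontr)
  assume ne: "P \<noteq> {0}"
  have sub: "subspace P" using subspace_set_bracket[of P P] P by simp
  have alg: "\<And>a b. a \<in> P \<Longrightarrow> b \<in> P \<Longrightarrow> bracket a b \<in> P" using set_bracketI P by blast
  define Q where "Q U \<longleftrightarrow> subspace U \<and> U \<subset> P \<and> (\<forall>a\<in>P. \<forall>b\<in>U. bracket a b \<in> U)" for U
  have "Q {0}" using ne subspace_0[OF sub] by (auto simp: Q_def bracket_simps)
  then obtain U where QU: "Q U" and max: "\<And>S. Q S \<Longrightarrow> U \<subseteq> S \<Longrightarrow> S = U"
    using maximal_subspace_exists[of Q] by (metis Q_def)
  have U: "subspace U" "U \<subset> P" "\<And>a b. a \<in> P \<Longrightarrow> b \<in> U \<Longrightarrow> bracket a b \<in> U"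
    using QU by (auto simp: Q_def)
  obtain v where v: "v \<in> P" "v \<notin> U" "\<And>a. a \<in> P \<Longrightarrow> bracket a v \<in> U"
    using engel_relative[OF sub alg nilp sub U(1,2) alg U(3)] by blast
  have br: "bracket a b \<in> U" if "a \<in> P" "b \<in> span (insert v U)" for a b
  proof -
    obtain i where "b - scale i v \<in> U" by (rule span_insert_subspaceE[OF \<open>b \<in> _\<close> U(1)])
    then have "bracket a (b - scale i v) + scale i (bracket a v) \<in> U"
      using that(1) U(1,3) v(3) by (intro subspace_add subspace_scale) auto
    then show ?thesis by (simp add: bracket_simps)
  qed
  have le: "U \<subseteq> span (insert v U)" "v \<in> span (insert v U)" by (auto intro: span_base)
  have "span (insert v U) \<subseteq> P" using v(1) U(2) sub by (intro span_minimal) auto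
  then have "Q (span (insert v U)) \<or> span (insert v U) = P" unfolding Q_def using br le by auto
  then have "span (insert v U) = P" using max le v(2) by metis
  then have "set_bracket P P \<subseteq> U" using br U(1) by (intro set_bracket_subset) auto
  then show False using P U(2) by blast
qed

section \<open>Differential ideals\<close>

definition ideal :: "'l set \<Rightarrow> bool" where
  "ideal I \<longleftrightarrow> subspace I \<and> (\<forall>l. \<forall>x\<in>I. bracket l x \<in> I)"

lemma killing_derivation:
  assumes "derivation d"
  shows "killing (d x) y = - killing x (d y)"
proof -
  have d: "Vector_Spaces.linear scale scale d" "\<And>x y. d (bracket x y) = bracket (d x) y + bracket x (d y)"
    using assms by (auto simp: derivation_def)
  have "Vector_Spaces.linear scale scale (\<lambda>z. bracket x (bracket y z))"
    by (rule linear_endoI) (simp_all add: bracket_simps)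
  then have "trace (\<lambda>z. d (bracket x (bracket y z))) = trace (\<lambda>z. bracket x (bracket y (d z)))"
    using trace_commute[OF d(1)] by blast
  then show ?thesis by (simp add: killing_def d(2) bracket_simps trace_simps eq_neg_iff_add_eq_0)
qed

lemma killing_derivation_trace:
  assumes "derivation d"
  shows "killing (d x) y = trace (\<lambda>z. d (bracket (bracket x y) z))"
proof -
  have d: "Vector_Spaces.linear scale scale d" "\<And>x y. d (bracket x y) = bracket (d x) y + bracket x (d y)"
    using assms by (auto simp: derivation_def)
  then have dh: "module_hom scale scale d" by (simp add: linear_iff_module_hom)
  have "Vector_Spaces.linear scale scale (\<lambda>z. d (bracket y z))"
    using dh by (intro linear_endoI) (simp_all add: bracket_simps module_hom.add module_hom.scale)
  then have "trace (\<lambda>z. bracket x (d (bracket y z))) = trace (\<lambda>z. d (bracket y (bracket x z)))"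
    using trace_commute[OF linear_bracket_right] by blast
  moreover have "bracket (d x) (bracket y z) = d (bracket x (bracket y z)) - bracket x (d (bracket y z))" for z
    by (simp add: d(2)[of x])
  ultimately show ?thesis
    by (simp only: killing_def bracket_bracket module_hom.diff[OF dh] trace_simps)
qed

lemma killing_representable:
  assumes P: "subspace P" and nondeg: "\<And>x. x \<in> P \<Longrightarrow> (\<And>y. y \<in> P \<Longrightarrow> killing x y = 0) \<Longrightarrow> x = 0"
    and f: "\<And>x y. f (x + y) = f x + f y" "\<And>a x. f (scale a x) = a * f x"
  shows "\<exists>p\<in>P. \<forall>x\<in>P. killing p x = f x"
proof -
  obtain C where C: "C \<subseteq> P" "independent C" "P \<subseteq> span C" "card C = dim P" using basis_exists by blast
  have finC: "finite C" using C(2) by (rule finiteI_independent)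
  have spanC: "span C = P" using C P by (metis span_subspace)
  have ext: "\<forall>x\<in>P. killing p x = g x" if "\<And>c. c \<in> C \<Longrightarrow> killing p c = g c"
    and g: "\<And>x y. g (x + y) = g x + g y" "\<And>a x. g (scale a x) = a * g x" for p g
  proof
    fix x assume "x \<in> P"
    then have "x \<in> span C" using spanC by simp
    moreover have "g 0 = 0" using g(1)[of 0 0] by simp
    ultimately show "killing p x = g x"
      by (induction rule: span_induct_alt) (simp_all add: that(1) g killing_simps killing_0)
  qed
  have coeffs: "u c = w c" if "(\<Sum>c\<in>C. scale (u c) c) = (\<Sum>c\<in>C. scale (w c) c)" "c \<in> C" for u w c
  proof -
    have "(\<Sum>c\<in>C. scale (u c - w c) c) = 0"
      using that(1) by (simp add: scale_left_diff_distrib sum_subtractf)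
    then show ?thesis using independentD[OF C(2) finC subset_refl, of "\<lambda>c. u c - w c"] that(2) by simp
  qed
  define \<Phi> where "\<Phi> x = (\<Sum>c\<in>C. scale (killing x c) c)" for x
  have \<Phi>: "Vector_Spaces.linear scale scale \<Phi>"
    by (rule linear_endoI) (simp_all add: \<Phi>_def killing_simps scale_left_distrib sum.distrib scale_sum_right)
  then have hom: "module_hom scale scale \<Phi>" by (simp add: linear_iff_module_hom)
  have "x = 0" if "x \<in> P" "\<Phi> x = 0" for x
  proof -
    have "killing x c = 0" if "c \<in> C" for c
      using coeffs[of "killing x" "\<lambda>_. 0"] \<open>\<Phi> x = 0\<close> that by (simp add: \<Phi>_def)
    then have "\<forall>y\<in>P. killing x y = 0" using ext[of x "\<lambda>_. 0"] by simp
    then show ?thesis using nondeg \<open>x \<in> P\<close> by blast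
  qed
  then have inj: "inj_on \<Phi> (span C)"
    by (subst module_hom.inj_on_iff_eq_0[OF hom subspace_span]) (simp add: spanC)
  have ind: "independent (\<Phi> ` C)" using module_hom.independent_injective_image[OF hom C(2) inj] .
  have "card (\<Phi> ` C) = dim P"
    using C(4) inj by (metis card_image inj_on_subset span_superset)
  moreover have "\<Phi> ` C \<subseteq> P"
    unfolding \<Phi>_def using C(1) P by (auto intro!: subspace_sum subspace_scale)
  ultimately have "P \<subseteq> span (\<Phi> ` C)" using ind card_ge_dim_independent by (metis order_refl)
  also have "span (\<Phi> ` C) = \<Phi> ` P" using module_hom.span_image[OF hom] spanC by simp
  finally have "P \<subseteq> \<Phi> ` P" .
  moreover have "(\<Sum>c\<in>C. scale (f c) c) \<in> P"
    using C(1) by (intro subspace_sum[OF P] subspace_scale[OF P]) auto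
  ultimately have "(\<Sum>c\<in>C. scale (f c) c) \<in> \<Phi> ` P" by blast
  then obtain p where p: "p \<in> P" "(\<Sum>c\<in>C. scale (f c) c) = (\<Sum>c\<in>C. scale (killing p c) c)"
    by (auto simp: \<Phi>_def)
  have "killing p c = f c" if "c \<in> C" for c using coeffs[OF p(2) that] by simp
  then show ?thesis using ext[of p f] f p(1) by blast
qed

lemma differential_simple_perfect_trivial:
  assumes d: "derivation d" and P: "ideal P" "set_bracket P P = P" "d ` P \<subseteq> P" "P \<subseteq> range d"
    and simple: "\<And>I. ideal I \<Longrightarrow> I \<subseteq> P \<Longrightarrow> d ` I \<subseteq> I \<Longrightarrow> I = {0} \<or> I = P"
  shows "P = {0}"
proof -
  have dh: "module_hom scale scale d" using d by (simp add: derivation_def linear_iff_module_hom)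
  have sub: "subspace P" and idl: "\<And>l x. x \<in> P \<Longrightarrow> bracket l x \<in> P" using P(1) by (auto simp: ideal_def)
  define S where "S = {x\<in>P. \<forall>y\<in>P. killing x y = 0}"
  have "subspace S"
    by (rule subspaceI)
      (auto simp: S_def killing_simps killing_0 subspace_0[OF sub] subspace_add[OF sub] subspace_scale[OF sub])
  moreover have "bracket l x \<in> S" if "x \<in> S" for l x
  proof -
    have "killing (bracket l x) y = - killing x (bracket l y)" for y
      using killing_invariant[of x l y] by (subst bracket_anti) (simp add: killing_neg)
    then show ?thesis using that idl by (simp add: S_def)
  qed
  ultimately have "ideal S" by (simp add: ideal_def)
  moreover have "d ` S \<subseteq> S" using P(3) by (auto simp: S_def killing_derivation[OF d])
  moreover have "S \<subseteq> P" by (auto simp: S_def)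
  ultimately have "S = {0} \<or> S = P" by (intro simple)
  then show ?thesis
  proof
    assume "S = P"
    have rad: "killing x l = 0" if "x \<in> P" for x l
    proof -
      have "x \<in> span {bracket a b |a b. a \<in> P \<and> b \<in> P}" using that P(2) by (simp add: set_bracket_def)
      then show ?thesis
      proof (induction rule: span_induct_alt)
        case (step c z y)
        then obtain a b where ab: "z = bracket a b" "a \<in> P" "b \<in> P" by blast
        have "bracket b l \<in> P" using idl[OF ab(3), of l] bracket_anti[of b l] subspace_neg[OF sub] by simp
        then have "killing z l = 0" using ab(1,2) \<open>S = P\<close> by (auto simp: S_def killing_invariant)
        then show ?case using step by (simp add: killing_simps)
      qed (simp add: killing_0)
    qed
    have "\<exists>k. (bracket x ^^ k) v = 0" if "x \<in> P" for x v
    proof (rule killing_radical_ad_nilpotent)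
      have "{bracket a b |a b. a \<in> P \<and> b \<in> P} \<subseteq> {bracket u v |u v. \<forall>w. killing u w = 0}"
        using rad by blast
      then show "x \<in> span {bracket u v |u v. \<forall>w. killing u w = 0}"
        using that P(2) span_mono unfolding set_bracket_def by blast
    qed
    then show "P = {0}" using perfect_ad_nilpotent_trivial[OF P(2)] by blast
  next
    assume S0: "S = {0}"
    then have nondeg: "x = 0" if "x \<in> P" "\<And>y. y \<in> P \<Longrightarrow> killing x y = 0" for x
      using that by (auto simp: S_def)
    have inj: "x = 0" if "x \<in> P" "d x = 0" for x
    proof (rule nondeg[OF that(1)])
      fix y assume "y \<in> P"
      then obtain z where "y = d z" using P(4) by blast
      then show "killing x y = 0" using killing_derivation[OF d, of x z] that(2) by (simp add: killing_0)
    qed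
    define f where "f x = trace (\<lambda>z. d (bracket x z))" for x
    have "f (x + y) = f x + f y" "f (scale a x) = a * f x" for x y a
      by (simp_all add: f_def bracket_simps module_hom.add[OF dh] module_hom.scale[OF dh] trace_simps)
    then obtain p where p: "p \<in> P" "\<And>x. x \<in> P \<Longrightarrow> killing p x = f x"
      using killing_representable[OF sub nondeg, of f] by blast
    have "d x = bracket p x" if x: "x \<in> P" for x
    proof -
      have "d x - bracket p x = 0"
      proof (rule nondeg)
        show "d x - bracket p x \<in> P" using x P(3) idl by (auto intro: subspace_diff[OF sub])
        fix y assume "y \<in> P"
        then have "killing (d x) y = killing p (bracket x y)"
          using p(2) idl by (simp add: killing_derivation_trace[OF d] f_def)
        then show "killing (d x - bracket p x) y = 0" by (simp add: killing_simps killing_invariant)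
      qed
      then show ?thesis by simp
    qed
    then have "p = 0" "\<And>x. x \<in> P \<Longrightarrow> d x = bracket p x" using p(1) inj bracket_self by auto
    then have "x = 0" if "x \<in> P" for x using inj that by (simp add: bracket_simps)
    then show "P = {0}" using subspace_0[OF sub] by blast
  qed
qed

lemma projection_with_kernel:
  assumes R: "subspace R"
  obtains \<pi> where "Vector_Spaces.linear scale scale \<pi>" "\<And>x. \<pi> x = 0 \<longleftrightarrow> x \<in> R" "\<And>x. x - \<pi> x \<in> R"
proof -
  interpret P: vector_space_pair scale scale ..
  obtain C where C: "C \<subseteq> R" "independent C" "R \<subseteq> span C" "card C = dim R" using basis_exists by blast
  have spanC: "span C = R" using C R by (metis span_subspace)
  define B where "B = extend_basis C"
  have B: "C \<subseteq> B" "independent B" "span B = UNIV"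
    using extend_basis_superset[OF C(2)] independent_extend_basis[OF C(2)] span_extend_basis[OF C(2)]
    by (simp_all add: B_def)
  obtain \<pi> where \<pi>: "Vector_Spaces.linear scale scale \<pi>" "\<And>b. b \<in> B \<Longrightarrow> \<pi> b = (if b \<in> C then 0 else b)"
    using P.linear_independent_extend[OF B(2), of "\<lambda>b. if b \<in> C then 0 else b"] by blast
  have hom: "module_hom scale scale \<pi>" using \<pi>(1) by (simp add: linear_iff_module_hom)
  have ker: "\<pi> x = 0" if "x \<in> R" for x
    using module_hom.eq_0_on_span[OF hom, of C] \<pi>(2) B(1) that spanC by (metis subsetD)
  have diff: "x - \<pi> x \<in> R" for x
  proof -
    have "x \<in> span B" using B(3) by simp
    then show ?thesis
    proof (induction rule: span_induct_alt)
      case base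
      show ?case using subspace_0[OF R] by (simp add: module_hom.zero[OF hom])
    next
      case (step c b y)
      have "b - \<pi> b \<in> R" using \<pi>(2)[OF step(1)] C(1) subspace_0[OF R] by auto
      then have "scale c (b - \<pi> b) + (y - \<pi> y) \<in> R" using step(2) by (intro subspace_add subspace_scale R)
      then show ?case
        by (simp add: module_hom.add[OF hom] module_hom.scale[OF hom] scale_right_diff_distrib algebra_simps)
    qed
  qed
  have "x \<in> R" if "\<pi> x = 0" for x using diff[of x] that by simp
  then show ?thesis using that \<pi>(1) ker diff by blast
qed

text \<open>The quotient by an ideal \<open>R\<close> of a differential Lie algebra is modelled without changing
  the type: with \<open>\<pi>\<close> a linear projection along \<open>R\<close>, the bracket \<open>\<pi> [x, y]\<close> makes the whole space
  the direct sum of the quotient and a central copy of \<open>R\<close>.\<close>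

theorem differential_perfect_ideal_trivial:
  assumes d: "derivation d" and P: "ideal P" "set_bracket P P = P" "d ` P \<subseteq> P" "P \<subseteq> range d"
  shows "P = {0}"
proof (rule ccontr)
  assume ne: "P \<noteq> {0}"
  have d_br: "\<And>x y. d (bracket x y) = bracket (d x) y + bracket x (d y)"
    using d by (auto simp: derivation_def)
  have dh: "module_hom scale scale d" using d by (simp add: derivation_def linear_iff_module_hom)
  have sub: "subspace P" and idl: "\<And>l x. x \<in> P \<Longrightarrow> bracket l x \<in> P" using P(1) by (auto simp: ideal_def)
  define Q where "Q R \<longleftrightarrow> ideal R \<and> R \<subset> P \<and> d ` R \<subseteq> R" for R
  have "Q {0}" using ne subspace_0[OF sub] module_hom.zero[OF dh] by (auto simp: Q_def ideal_def bracket_simps)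
  then obtain R where QR: "Q R" and max: "\<And>S. Q S \<Longrightarrow> R \<subseteq> S \<Longrightarrow> S = R"
    using maximal_subspace_exists[of Q] by (metis Q_def ideal_def)
  have R: "subspace R" "R \<subset> P" "d ` R \<subseteq> R" and R_idl: "\<And>l x. x \<in> R \<Longrightarrow> bracket l x \<in> R"
    using QR by (auto simp: Q_def ideal_def)
  obtain \<pi> where \<pi>: "Vector_Spaces.linear scale scale \<pi>" "\<And>x. \<pi> x = 0 \<longleftrightarrow> x \<in> R" "\<And>x. x - \<pi> x \<in> R"
    using projection_with_kernel[OF R(1)] by metis
  have hom: "module_hom scale scale \<pi>" using \<pi>(1) by (simp add: linear_iff_module_hom)
  note \<pi>_simps = module_hom.add[OF hom] module_hom.diff[OF hom] module_hom.scale[OF hom] module_hom.zero[OF hom]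
  have \<pi>_eqI: "\<pi> x = \<pi> y" if "x - y \<in> R" for x y
    using \<pi>(2)[of "x - y"] that by (simp add: \<pi>_simps)
  have \<pi>_br: "\<pi> (bracket x (\<pi> y)) = \<pi> (bracket x y)" "\<pi> (bracket (\<pi> x) y) = \<pi> (bracket x y)" for x y
  proof -
    have r: "\<pi> z - z \<in> R" for z using subspace_neg[OF R(1) \<pi>(3)[of z]] by simp
    show "\<pi> (bracket x (\<pi> y)) = \<pi> (bracket x y)"
      using R_idl[OF r[of y], of x] by (intro \<pi>_eqI) (simp add: bracket_simps)
    have "bracket (\<pi> x - x) y \<in> R"
      using R_idl[OF r[of x], of y] bracket_anti[of "\<pi> x - x" y] subspace_neg[OF R(1)] by simp
    then show "\<pi> (bracket (\<pi> x) y) = \<pi> (bracket x y)" by (intro \<pi>_eqI) (simp add: bracket_simps)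
  qed
  have \<pi>_d: "\<pi> (d (\<pi> x)) = \<pi> (d x)" for x
  proof -
    have "d (x - \<pi> x) \<in> R" using \<pi>(3) R(3) by blast
    then show ?thesis by (intro \<pi>_eqI[symmetric]) (simp add: module_hom.diff[OF dh])
  qed
  define br where "br x y = \<pi> (bracket x y)" for x y
  define d' where "d' x = \<pi> (d x)" for x
  define P' where "P' = \<pi> ` P"
  interpret L': fd_lie_algebra scale br Basis
  proof (intro fd_lie_algebra.intro lie_algebra.intro lie_algebra_axioms.intro)
    show "vector_space scale" "finite_dimensional_vector_space scale Basis" "linear_space scale"
      by unfold_locales
    show "Vector_Spaces.linear scale scale (br x)" "Vector_Spaces.linear scale scale (\<lambda>x. br x y)" for x y
      by (auto intro!: linear_endoI simp: br_def bracket_simps \<pi>_simps)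
    show "br x x = 0" for x by (simp add: br_def bracket_self \<pi>_simps)
    show "br x (br y z) + br y (br z x) + br z (br x y) = 0" for x y z
      by (simp add: br_def \<pi>_br \<pi>_simps(1)[symmetric] jacobi \<pi>_simps(4))
  qed
  have "P' = {0}"
  proof (rule L'.differential_simple_perfect_trivial[of d'])
    show "L'.derivation d'"
      unfolding L'.derivation_def
      by (auto intro!: linear_endoI simp: d'_def br_def \<pi>_d \<pi>_br d_br \<pi>_simps module_hom.add[OF dh] module_hom.scale[OF dh])
    have subP': "subspace P'" unfolding P'_def using module_hom.subspace_image[OF hom sub] .
    show "L'.ideal P'"
      unfolding L'.ideal_def using subP' idl by (auto simp: P'_def br_def \<pi>_br)
    show "d' ` P' \<subseteq> P'" using P(3) by (auto simp: P'_def d'_def \<pi>_d)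
    show "P' \<subseteq> range d'"
      using P(4) by (force simp: P'_def d'_def)
    show "L'.set_bracket P' P' = P'"
    proof -
      have "P' = \<pi> ` span {bracket a b |a b. a \<in> P \<and> b \<in> P}"
        using P(2) by (simp add: P'_def set_bracket_def)
      also have "\<dots> = span (\<pi> ` {bracket a b |a b. a \<in> P \<and> b \<in> P})"
        using module_hom.span_image[OF hom] by simp
      also have "\<pi> ` {bracket a b |a b. a \<in> P \<and> b \<in> P} = {br (\<pi> a) (\<pi> b) |a b. a \<in> P \<and> b \<in> P}"
        unfolding br_def \<pi>_br by blast
      also have "\<dots> = {br a b |a b. a \<in> P' \<and> b \<in> P'}"
        unfolding P'_def by blast
      finally show ?thesis by (simp add: L'.set_bracket_def)
    qed
    fix I assume I: "L'.ideal I" "I \<subseteq> P'" "d' ` I \<subseteq> I"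
    have subI: "subspace I" and idlI: "\<And>l x. x \<in> I \<Longrightarrow> br l x \<in> I" using I(1) by (auto simp: L'.ideal_def)
    define J where "J = {x\<in>P. \<pi> x \<in> I}"
    have "subspace J"
      by (rule subspaceI)
        (auto simp: J_def \<pi>_simps subspace_0[OF sub] subspace_add[OF sub] subspace_scale[OF sub]
          subspace_0[OF subI] subspace_add[OF subI] subspace_scale[OF subI])
    moreover have "bracket l x \<in> J" if "x \<in> J" for l x
      using that idl idlI[of "\<pi> x" l] by (simp add: J_def br_def \<pi>_br)
    ultimately have "ideal J" by (simp add: ideal_def)
    moreover have "\<pi> (d x) = d' (\<pi> x)" for x by (simp add: d'_def \<pi>_d)
    then have "d ` J \<subseteq> J" using I(3) P(3) by (auto simp: J_def)
    moreover have "R \<subseteq> J"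
    proof
      fix x assume "x \<in> R"
      then show "x \<in> J" using R(2) \<pi>(2)[of x] subspace_0[OF subI] by (auto simp: J_def)
    qed
    ultimately have "J = R \<or> J = P" using max[of J] by (auto simp: Q_def J_def)
    then show "I = {0} \<or> I = P'"
    proof
      assume J: "J = R"
      have "x = 0" if "x \<in> I" for x
      proof -
        obtain p where p: "p \<in> P" "x = \<pi> p" using \<open>x \<in> I\<close> I(2) by (auto simp: P'_def)
        then have "p \<in> J" using that by (simp add: J_def)
        then show ?thesis using J \<pi>(2) p(2) by simp
      qed
      then show ?thesis using subspace_0[OF subI] by blast
    next
      assume "J = P"
      then show ?thesis using I(2) by (auto simp: J_def P'_def)
    qed
  qed
  then have "P \<subseteq> R" using \<pi>(2) by (auto simp: P'_def)
  then show False using R(2) by blast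
qed

lemma derived_series_ideal:
  assumes "derivation d"
  shows "ideal (derived_series k) \<and> d ` derived_series k \<subseteq> derived_series k"
proof (induction k)
  case 0
  show ?case by (simp add: ideal_def)
next
  case (Suc k)
  let ?D = "derived_series k" and ?E = "derived_series (Suc k)"
  have sub: "subspace ?E" by (simp add: subspace_set_bracket)
  have "bracket l x \<in> ?E" if "x \<in> ?E" for l x
  proof -
    have "Vector_Spaces.linear scale scale (bracket l)" by (rule linear_bracket_right)
    then have "subspace {x. bracket l x \<in> ?E}"
      using module_hom.subspace_linear_preimage sub by (auto simp: linear_iff_module_hom)
    moreover have "bracket l (bracket a b) \<in> ?E" if "a \<in> ?D" "b \<in> ?D" for a b
    proof -
      have "bracket (bracket l a) b \<in> ?E" "bracket a (bracket l b) \<in> ?E"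
        using that Suc.IH by (auto simp: ideal_def intro!: set_bracketI)
      then have "bracket (bracket l a) b + bracket a (bracket l b) \<in> ?E" by (rule subspace_add[OF sub])
      then show ?thesis by (simp add: bracket_bracket)
    qed
    ultimately have "?E \<subseteq> {x. bracket l x \<in> ?E}" unfolding derived_series.simps
      by (intro set_bracket_subset) auto
    then show ?thesis using that by blast
  qed
  moreover have "?E \<subseteq> {x. d x \<in> ?E}"
  proof -
    have d: "Vector_Spaces.linear scale scale d" "\<And>x y. d (bracket x y) = bracket (d x) y + bracket x (d y)"
      using assms by (auto simp: derivation_def)
    have "subspace {x. d x \<in> ?E}"
      using d(1) module_hom.subspace_linear_preimage sub by (auto simp: linear_iff_module_hom)
    moreover have "d (bracket a b) \<in> ?E" if "a \<in> ?D" "b \<in> ?D" for a b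
    proof -
      have "bracket (d a) b \<in> ?E" "bracket a (d b) \<in> ?E"
        using that Suc.IH by (auto intro!: set_bracketI)
      then show ?thesis unfolding d(2) by (rule subspace_add[OF sub])
    qed
    ultimately show ?thesis unfolding derived_series.simps
      by (intro set_bracket_subset) auto
  qed
  ultimately show ?case using sub by (auto simp: ideal_def)
qed

lemma derived_series_stabilises: "\<exists>k. derived_series (Suc k) = derived_series k"
proof (rule ccontr)
  assume ne: "\<nexists>k. derived_series (Suc k) = derived_series k"
  have sub: "subspace (derived_series k)" for k by (cases k) (simp_all add: subspace_set_bracket)
  have zero: "derivation (\<lambda>_. 0)" unfolding derivation_def by (auto intro!: linear_endoI simp: bracket_simps)
  have "derived_series (Suc k) \<subseteq> derived_series k" for k
    using derived_series_ideal[OF zero, of k] unfolding derived_series.simps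
    by (intro set_bracket_subset) (auto simp: ideal_def)
  then have less: "dim (derived_series (Suc k)) < dim (derived_series k)" for k
    using dim_psubset[of "derived_series (Suc k)" "derived_series k"] ne sub
    by (metis psubsetI span_eq_iff)
  have "dim (derived_series k) + k \<le> dim (derived_series 0)" for k
  proof (induction k)
    case (Suc k)
    then show ?case using less[of k] by linarith
  qed simp
  from this[of "Suc (dim (derived_series 0))"] show False by simp
qed

lemma perfect_subset_lower_central:
  assumes "set_bracket P P = P"
  shows "P \<subseteq> lower_central n"
proof -
  have "P \<subseteq> lower_central (Suc k)" for k
  proof (induction k)
    case (Suc k)
    have "set_bracket P P \<subseteq> lower_central (Suc (Suc k))"
      using Suc by (intro set_bracket_subset) (auto intro: set_bracketI simp: subspace_set_bracket)
    then show ?case using assms by simp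
  qed simp
  then show ?thesis by (cases n) auto
qed

theorem solvable_if_lower_central_subset_range:
  assumes d: "derivation d" and n: "lower_central n \<subseteq> range d"
  shows solvable
proof -
  obtain k where k: "derived_series (Suc k) = derived_series k" using derived_series_stabilises by blast
  have "derived_series k = {0}"
  proof (rule differential_perfect_ideal_trivial[OF d])
    show perfect: "set_bracket (derived_series k) (derived_series k) = derived_series k" using k by simp
    show "derived_series k \<subseteq> range d" using perfect_subset_lower_central[OF perfect] n by blast
  qed (use derived_series_ideal[OF d, of k] in auto)
  then show ?thesis by (auto simp: solvable_def)
qed

end

theorem mainTheorem3:
  fixes scale :: "'k::field_char_0 \<Rightarrow> 'l::ab_group_add \<Rightarrow> 'l"
    and bracket :: "'l \<Rightarrow> 'l \<Rightarrow> 'l"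
    and d :: "'l \<Rightarrow> 'l"
    and n :: nat
  assumes "lie_algebra scale bracket"
    and "\<exists>B. finite_dimensional_vector_space scale B"
    and "lie_algebra.derivation scale bracket d"
    and "n > 1"
    and "lie_algebra.lower_central scale bracket n \<subseteq> range d"
  shows "lie_algebra.solvable scale bracket"
proof -
  interpret lie_algebra scale bracket by fact
  obtain B where "finite_dimensional_vector_space scale B" using assms(2) by blast
  then interpret finite_dimensional_vector_space scale B .
  interpret fd_lie_algebra scale bracket B ..
  show ?thesis using solvable_if_lower_central_subset_range assms(3,5) .
qed

end
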